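(* Let $\mu_0$ be the probability measure whose moments are $\binom{3n}{n}\frac{1}{n+1}$, $n\ge0$. Then $\mu_0=\mu_1\boxplus\mu_2$, where $\mu_1=\mathbf{D}_2\varpi_{1/2}$, i.e. \[ \mu_1=\tfrac12\delta_0+\frac{\sqrt{8-(x-3)^2}}{4\pi x}\chi_{(3-\sqrt8,\,3+\sqrt8)}(x)\,dx, \] and $\mu_2=\tfrac12\delta_0+\tfrac12\varpi_1$, i.e. \[ \mu_2=\tfrac12\delta_0+\frac{\sqrt{4x-x^2}}{4\pi x}\chi_{(0,4)}(x)\,dx. \] Moreover $\mu_1$ and $\mu_2$ are infinitely divisible with respect to $\boxplus$, and consequently so is $\mu_0$.
   Context: For a compactly supported probability measure $\mu$ on $\mathbb{R}$, let $s_m(\mu)=\int t^m\,d\mu(t)$ and $M_\mu(z)=\sum_{m\ge0}s_m(\mu)z^m$. The $R$-transform $R_\mu$ is defined near $0$ by $R_\mu(zM_\mu(z))+1=M_\mu(z)$. The additive free convolution $\mu'\boxplus\mu''$ is the unique compactly supported probability measure with $R_{\mu'\boxplus\mu''}=R_{\mu'}+R_{\mu''}$. A measure $\mu$ is $\boxplus$-infinitely divisible if for every $N\ge1$ there is a probability measure $\nu_N$ with $\nu_N^{\boxplus N}=\mu$. For $c>0$, the dilation is $\mathbf{D}_c\mu(A)=\mu(A/c)$. For $t>0$, the Marchenko–Pastur distribution is \[ \varpi_t=\max\{1-t,0\}\delta_0+\frac{\sqrt{4t-(x-1-t)^2}}{2\pi x}\,dx, \] with absolutely continuous part on $[(1-\sqrt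 t)^2,(1+\sqrt t)^2]$. It has $R_{\varpi_t}(z)=\frac{tz}{1-z}$. *)

theory Defs
  imports "HOL-Probability.Probability" "HOL-Computational_Algebra.Formal_Power_Series"
begin

definition cs_prob :: "real measure \<Rightarrow> bool" where
  "cs_prob \<mu> \<longleftrightarrow> prob_space \<mu> \<and> sets \<mu> = sets borel \<and>
      (\<exists>K. compact K \<and> emeasure \<mu> (UNIV - K) = 0)"

definition moment :: "real measure \<Rightarrow> nat \<Rightarrow> real" where
  "moment \<mu> m = (\<integral>t. t ^ m \<partial>\<mu>)"

definition moment_fps :: "real measure \<Rightarrow> real fps" where
  "moment_fps \<mu> = Abs_fps (moment \<mu>)"

definition R_transform :: "real measure \<Rightarrow> real fps" where
  "R_transform \<mu> = (THE R. fps_compose R (fps_X * moment_fps \<mu>) + 1 = moment_fps \<mu>)"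

definition free_conv :: "real measure \<Rightarrow> real measure \<Rightarrow> real measure" where
  "free_conv \<mu>1 \<mu>2 = (THE \<mu>. cs_prob \<mu> \<and> R_transform \<mu> = R_transform \<mu>1 + R_transform \<mu>2)"

primrec free_conv_power :: "real measure \<Rightarrow> nat \<Rightarrow> real measure" where
  "free_conv_power \<nu> 0 = return borel 0"
| "free_conv_power \<nu> (Suc n) = free_conv (free_conv_power \<nu> n) \<nu>"

definition free_inf_div :: "real measure \<Rightarrow> bool" where
  "free_inf_div \<mu> \<longleftrightarrow> (\<forall>N::nat. N \<ge> 1 \<longrightarrow> (\<exists>\<nu>. cs_prob \<nu> \<and> free_conv_power \<nu> N = \<mu>))"

definition dilation :: "real \<Rightarrow> real measure \<Rightarrow> real measure" where
  "dilation c \<mu> = distr \<mu> borel (\<lambda>x. c * x)"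

definition mp_density :: "real \<Rightarrow> real \<Rightarrow> real" where
  "mp_density t x = (if (1 - sqrt t)^2 < x \<and> x < (1 + sqrt t)^2
       then sqrt (4 * t - (x - 1 - t)^2) / (2 * pi * x) else 0)"

definition marchenko_pastur :: "real \<Rightarrow> real measure" where
  "marchenko_pastur t = measure_of UNIV (sets borel)
     (\<lambda>A. ennreal (max (1 - t) 0) * indicator A (0::real)
          + (\<integral>\<^sup>+ x. indicator A x * ennreal (mp_density t x) \<partial>lborel))"

definition mu1 :: "real measure" where
  "mu1 = dilation 2 (marchenko_pastur (1/2))"

definition mu2 :: "real measure" where
  "mu2 = measure_of UNIV (sets borel)
     (\<lambda>A. ennreal (1/2) * indicator A (0::real) + ennreal (1/2) * emeasure (marchenko_pastur 1) A)"

end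

theory Submission
  imports Defs
begin

text \<open>The free cumulants of all three measures are nonnegative, and the shifted sequence
  \<open>n \<mapsto> \<kappa>(n + 2)\<close> is positive semidefinite. For such a measure and \<open>s \<in> [0, 1]\<close>, the
  formal solution \<open>M\<close> of \<open>sR(zM(z)) + 1 = M(z)\<close> can be written \<open>M = 1 / (1 - az - z\<^sup>2S)\<close>, where \<open>S\<close>
  is a mixture of series of the same shape containing \<open>S\<close> again; this makes the coefficients of
  \<open>M\<close> positive semidefinite, and since they are dominated by those for \<open>s = 1\<close>, they are the moments
  of a compactly supported measure with R-transform \<open>sR\<close>. Taking \<open>s = k/N\<close> gives the roots together
  with all their partial convolution powers.

  The R-transforms \<open>z / (1 - 2z)\<close> of \<open>\<mu>\<^sub>1\<close> and \<open>((1 - 2z)\<^bsup>-1/2\<^esup> - 1) / 2\<close> of \<open>\<mu>\<^sub>2\<close> come from the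
  Stieltjes transform of the semicircle density divided by \<open>x\<close>. For \<open>\<mu>\<^sub>0\<close> one substitutes
  \<open>z = v(1 - v)\<^sup>2\<close>, which turns the moment series into \<open>(B + B\<^sup>2) / 2\<close> with \<open>B = 1 / (1 - v)\<close> and
  \<open>1 - 2zM(z)\<close> into \<open>(1 - v)\<^sup>2\<close>, so that both R-transforms become rational in \<open>v\<close>.\<close>

unbundle no vec_syntax
unbundle fps_syntax

section \<open>Positive semidefinite sequences\<close>

text \<open>Both \<open>R_transform\<close> and \<open>free_conv\<close> are definite descriptions:
  a convolution can be evaluated only once a compactly supported measure with the summed R-transform
  is at hand. \<open>free_conv_power\<close> iterates this, so a root alone says nothing unless each
  intermediate power is a measure too. Existence is therefore a moment problem with exponentially
  bounded data, while uniqueness comes from characteristic functions. The positivity condition is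
  the free Levy-Khintchine form: \<open>R(z) = a z + c z^2 G(z)\<close> with \<open>G\<close> the
  moment series of a probability measure. Nonnegativity of the cumulants is a special feature of
  these measures: moments are polynomials in the cumulants with nonnegative coefficients, so
  shrinking the cumulants can only shrink the moments, and the exponential bound needs no analytic
  continuation. Analysis enters for the Marchenko-Pastur law, whose transform is computed at
  negative arguments only.\<close>

definition psd_upto :: "nat \<Rightarrow> (nat \<Rightarrow> real) \<Rightarrow> bool" where
  "psd_upto n a \<longleftrightarrow> (\<forall>p::nat \<Rightarrow> real. 0 \<le> (\<Sum>i<n. \<Sum>j<n. p i * p j * a (i + j)))"

lemma psd_uptoD: "psd_upto n a \<Longrightarrow> 0 \<le> (\<Sum>i<n. \<Sum>j<n. p i * p j * a (i + j))"
  by (simp add: psd_upto_def)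

lemma psd_upto_scale: "psd_upto n a \<Longrightarrow> 0 \<le> c \<Longrightarrow> psd_upto n (\<lambda>k. c * a k)"
proof -
  assume a: "psd_upto n a" "0 \<le> c"
  have "(\<Sum>i<n. \<Sum>j<n. p i * p j * (c * a (i + j))) = c * (\<Sum>i<n. \<Sum>j<n. p i * p j * a (i + j))" for p
    by (simp add: sum_distrib_left mult_ac)
  with a show ?thesis by (simp add: psd_upto_def)
qed

lemma psd_upto_add: "psd_upto n a \<Longrightarrow> psd_upto n b \<Longrightarrow> psd_upto n (\<lambda>k. a k + b k)"
  by (simp add: psd_upto_def distrib_left sum.distrib)

text \<open>A leading zero in the test vector turns \<open>p\<close> into \<open>x p\<close>, so the
  shifted form is the original one at \<open>x p\<close>; one size is lost.\<close>

lemma psd_upto_shift2: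
  assumes "psd_upto (Suc n) a" shows "psd_upto n (\<lambda>k. a (k + 2))"
  unfolding psd_upto_def
proof
  fix p :: "nat \<Rightarrow> real"
  define q where "q i = (case i of 0 \<Rightarrow> 0 | Suc i \<Rightarrow> p i)" for i
  have "(\<Sum>i<Suc n. \<Sum>j<Suc n. q i * q j * a (i + j)) = (\<Sum>i<n. \<Sum>j<n. p i * p j * a (i + j + 2))"
    by (simp add: sum.lessThan_Suc_shift q_def del: sum.lessThan_Suc)
  with psd_uptoD[OF assms, of q] show "0 \<le> (\<Sum>i<n. \<Sum>j<n. p i * p j * a (i + j + 2))" by simp
qed

lemma psd_upto_power: "psd_upto n (\<lambda>k. c ^ k)"
  unfolding psd_upto_def
proof
  fix p
  have "(\<Sum>i<n. \<Sum>j<n. p i * p j * c ^ (i + j)) = (\<Sum>i<n. p i * c ^ i)\<^sup>2"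
    by (simp add: power2_eq_square sum_product power_add mult_ac)
  then show "0 \<le> (\<Sum>i<n. \<Sum>j<n. p i * p j * c ^ (i + j))" by simp
qed

text \<open>The coefficients of \<open>1 / (1 - aX - X\<^sup>2S)\<close> are the vacuum moments \<open>\<langle>T\<^sup>i\<Omega>, T\<^sup>j\<Omega>\<rangle>\<close> of the operator
  \<open>T(\<alpha>, p) = (a\<alpha> + L\<^sub>S(p), \<alpha> + xp)\<close> on \<open>\<real> \<oplus> \<real>[x]\<close>, symmetric for the form
  \<open>\<alpha>\<beta> + L\<^sub>S(pq)\<close>; the right-hand side spells out that inner product.\<close>

lemma hankel_gram:
  fixes A S :: "nat \<Rightarrow> real"
  assumes 0: "A 0 = 1" and Suc: "\<And>n. A (Suc n) = a * A n + (\<Sum>k<n. S k * A (n - 1 - k))"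
  shows "A (i + j) = A i * A j + (\<Sum>k<i. \<Sum>l<j. A (i - 1 - k) * A (j - 1 - l) * S (k + l))"
proof -
  define F where "F i j = A i * A j + (\<Sum>k<i. \<Sum>l<j. A (i - 1 - k) * A (j - 1 - l) * S (k + l))" for i j
  define Z where "Z i j = (\<Sum>k<i. \<Sum>l<j. A (i - 1 - k) * A (j - 1 - l) * S (Suc (k + l)))" for i j
  have 1: "F (Suc i) j = A (Suc i) * A j + A i * (A (Suc j) - a * A j) + Z i j" for i j
  proof -
    have "F (Suc i) j = A (Suc i) * A j + (\<Sum>l<j. A i * A (j - 1 - l) * S l)
       + (\<Sum>k<i. \<Sum>l<j. A (i - Suc k) * A (j - 1 - l) * S (Suc (k + l)))"
      unfolding F_def by (subst sum.lessThan_Suc_shift) simp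
    moreover have "(\<Sum>l<j. A i * A (j - 1 - l) * S l) = A i * (A (Suc j) - a * A j)"
      by (simp add: Suc sum_distrib_left mult_ac)
    ultimately show ?thesis by (simp add: Z_def)
  qed
  have sym: "F i j = F j i" for i j
    unfolding F_def by (subst sum.swap) (simp add: mult_ac add.commute)
  have symZ: "Z i j = Z j i" for i j
    unfolding Z_def by (subst sum.swap) (simp add: mult_ac add.commute)
  \<comment> \<open>The right-hand side of \<open>1\<close> is invariant under exchanging
    \<open>i\<close> and \<open>j\<close>, which is the symmetry of the operator. With
    \<open>sym\<close> this moves one unit from one index to the other.\<close>
  have 2: "F (Suc i) j = F i (Suc j)" for i j
    using 1[of i j] 1[of j i] sym[of i "Suc j"] symZ[of i j] by (simp add: algebra_simps)
  have "F i j = A (i + j)"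
  proof (induction i arbitrary: j)
    case 0 then show ?case by (simp add: F_def assms(1))
  next
    case (Suc i) then show ?case by (simp add: 2)
  qed
  then show ?thesis by (simp add: F_def)
qed

text \<open>By \<open>hankel_gram\<close> the form of \<open>A\<close> is a perfect square plus the
  form of \<open>S\<close> at the vector \<open>V\<close>. Rows \<open>i \<le> n\<close> meet only
  indices \<open>k < i\<close>, so \<open>V\<close> has length \<open>n\<close> and one size is
  gained.\<close>

lemma psd_upto_jacobi:
  assumes "A 0 = 1" and "\<And>n. A (Suc n) = a * A n + (\<Sum>k<n. S k * A (n - 1 - k))"
    and S: "psd_upto n S"
  shows "psd_upto (Suc n) A"
  unfolding psd_upto_def
proof
  fix p :: "nat \<Rightarrow> real"
  \<comment> \<open>Extension by zero removes the dependence of the range of \<open>k\<close> on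
    \<open>i\<close>, so that the four sums can be interchanged.\<close>
  define G where "G i k = (if k < i then p i * A (i - 1 - k) else 0)" for i k
  define V where "V k = (\<Sum>i<Suc n. G i k)" for k
  have *: "(\<Sum>k<i. \<Sum>l<j. p i * p j * (A (i - 1 - k) * A (j - 1 - l) * S (k + l)))
     = (\<Sum>k<n. \<Sum>l<n. G i k * G j l * S (k + l))" if "i < Suc n" "j < Suc n" for i j
  proof -
    have "(\<Sum>l<j. p i * p j * (A (i - 1 - k) * A (j - 1 - l) * S (k + l)))
      = (\<Sum>l<n. G i k * G j l * S (k + l))" if "k < i" for k
      using that \<open>j < Suc n\<close> by (intro sum.mono_neutral_cong_left) (auto simp: G_def)
    moreover have "(\<Sum>l<n. G i k * G j l * S (k + l)) = 0" if "\<not> k < i" for k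
      using that by (simp add: G_def)
    ultimately show ?thesis
      using \<open>i < Suc n\<close> by (subst sum.mono_neutral_cong_left[of "{..<n}" "{..<i}"]) auto
  qed
  have "(\<Sum>i<Suc n. \<Sum>j<Suc n. p i * p j * A (i + j)) =
     (\<Sum>i<Suc n. \<Sum>j<Suc n. p i * A i * (p j * A j) + (\<Sum>k<n. \<Sum>l<n. G i k * G j l * S (k + l)))"
    by (intro sum.cong refl, subst hankel_gram[OF assms(1,2)], subst *[symmetric])
       (simp_all add: distrib_left sum_distrib_left mult_ac)
  also have "\<dots> = (\<Sum>i<Suc n. p i * A i)\<^sup>2 + (\<Sum>i<Suc n. \<Sum>j<Suc n. \<Sum>k<n. \<Sum>l<n. G i k * G j l * S (k + l))"
    by (simp only: sum.distrib power2_eq_square sum_product)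
  also have "(\<Sum>i<Suc n. \<Sum>j<Suc n. \<Sum>k<n. \<Sum>l<n. G i k * G j l * S (k + l))
     = (\<Sum>i<Suc n. \<Sum>k<n. \<Sum>j<Suc n. \<Sum>l<n. G i k * G j l * S (k + l))"
    by (intro sum.cong refl sum.swap)
  also have "\<dots> = (\<Sum>k<n. \<Sum>i<Suc n. \<Sum>l<n. \<Sum>j<Suc n. G i k * G j l * S (k + l))"
    by (subst sum.swap, intro sum.cong refl sum.swap)
  also have "\<dots> = (\<Sum>k<n. \<Sum>l<n. \<Sum>i<Suc n. \<Sum>j<Suc n. G i k * G j l * S (k + l))"
    by (intro sum.cong refl sum.swap)
  also have "\<dots> = (\<Sum>k<n. \<Sum>l<n. V k * V l * S (k + l))"
    unfolding V_def sum_product by (simp only: sum_distrib_right)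
  finally show "0 \<le> (\<Sum>i<Suc n. \<Sum>j<Suc n. p i * p j * A (i + j))"
    using psd_uptoD[OF S, of V] by simp
qed

lemma fps_jacobi_rec:
  fixes A S :: "real fps"
  assumes "A * (1 - fps_const a * fps_X - fps_X^2 * S) = 1"
  shows "A $ 0 = 1" "A $ Suc n = a * A $ n + (\<Sum>k<n. S $ k * A $ (n - 1 - k))"
proof -
  from assms have eq: "A = 1 + fps_X * (fps_const a * A + fps_X * (S * A))"
    by (simp add: algebra_simps power2_eq_square)
  show "A $ 0 = 1" by (subst eq) simp
  have "A $ Suc n = a * A $ n + (fps_X * (S * A)) $ n" by (subst eq) simp
  also have "(fps_X * (S * A)) $ n = (\<Sum>k<n. S $ k * A $ (n - 1 - k))"
    unfolding fps_X_mult_nth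
    by (cases n) (simp_all add: fps_mult_nth lessThan_Suc_atMost atMost_atLeast0)
  finally show "A $ Suc n = a * A $ n + (\<Sum>k<n. S $ k * A $ (n - 1 - k))" .
qed

lemma psd_upto_fps_jacobi:
  fixes A S :: "real fps"
  assumes "A * (1 - fps_const a * fps_X - fps_X^2 * S) = 1" "psd_upto n (fps_nth S)"
  shows "psd_upto (Suc n) (fps_nth A)"
  using psd_upto_jacobi[OF fps_jacobi_rec[OF assms(1)] assms(2)] .

section \<open>The functional equation of the R-transform\<close>

lemma fps_inverse_geometric: "inverse (1 - fps_const t * fps_X) = Abs_fps (\<lambda>n. t ^ n)"
  for t :: "'a::field"
proof (rule fps_inverse_unique)
  show "(1 - fps_const t * fps_X) * Abs_fps ((^) t) = 1"
  proof (rule fps_ext)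
    fix n show "((1 - fps_const t * fps_X) * Abs_fps ((^) t)) $ n = 1 $ n"
      by (cases n) (simp_all add: algebra_simps)
  qed
qed

lemma fps_inv_unique:
  fixes K W :: "'a::field fps"
  assumes "K $ 0 = 0" "K $ 1 \<noteq> 0" "W $ 0 = 0" "K oo W = fps_X"
  shows "W = fps_inv K"
proof -
  have "W = (fps_inv K oo K) oo W" using assms by (simp add: fps_inv)
  also have "\<dots> = fps_inv K" 
    using assms by (subst fps_compose_assoc[symmetric]) simp_all
  finally show ?thesis .
qed

text \<open>Constant term 1 makes \<open>fps_X * M\<close> invertible under composition, so that
  each of \<open>R\<close> and \<open>M\<close> determines the other.\<close>

definition R_fun_eq :: "real fps \<Rightarrow> real fps \<Rightarrow> bool" where
  "R_fun_eq R M \<longleftrightarrow> M $ 0 = 1 \<and> (R oo (fps_X * M)) + 1 = M"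

lemma R_fun_eq_nth_0: "R_fun_eq R M \<Longrightarrow> R $ 0 = 0"
  unfolding R_fun_eq_def by (metis add_cancel_left_left fps_add_nth fps_compose_nth_0 fps_one_nth)

lemma R_fun_eq_unique_R: "R_fun_eq R M \<Longrightarrow> R_fun_eq R' M \<Longrightarrow> R = R'"
  by (subst fps_compose_inj_right[of "fps_X * M", symmetric])
     (auto simp: R_fun_eq_def fps_mult_nth_1, metis add_right_cancel)

lemma ex_R_eq:
  assumes "M $ 0 = 1" shows "\<exists>R. R_fun_eq R M"
proof -
  have "((M - 1) oo fps_inv (fps_X * M)) oo (fps_X * M) = M - 1"
    using assms fps_inv[of "fps_X * M"]
    by (subst fps_compose_assoc[symmetric]) (simp_all add: fps_inv_def)
  with assms show ?thesis
    unfolding R_fun_eq_def by (intro exI[of _ "(M - 1) oo fps_inv (fps_X * M)"]) simp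
qed

text \<open>Substituting \<open>1 + R(XM) = M\<close> into \<open>X / (1 + R)\<close> gives
  \<open>XM / M = X\<close>. The functional equation is thus a compositional inversion, which
  settles uniqueness and existence of \<open>M\<close>.\<close>

lemma R_fun_eq_fps_inv:
  assumes "R_fun_eq R M"
  shows "fps_X * M = fps_inv (fps_X * inverse (1 + R))"
proof (rule fps_inv_unique)
  have R0: "R $ 0 = 0" by (rule R_fun_eq_nth_0[OF assms])
  have M: "M $ 0 = 1" "(R oo (fps_X * M)) = M - 1"
    using assms by (auto simp: R_fun_eq_def algebra_simps)
  have "fps_X * inverse (1 + R) oo fps_X * M = fps_X * M * inverse M"
    using R0 M by (simp add: fps_compose_mult_distrib fps_inverse_compose fps_compose_add_distrib)
  also have "\<dots> = fps_X" using M by (simp add: inverse_mult_eq_1' mult.assoc)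
  finally show "fps_X * inverse (1 + R) oo fps_X * M = fps_X" .
qed (use R_fun_eq_nth_0[OF assms] in \<open>simp_all add: fps_mult_nth_1\<close>)

lemma R_fun_eq_unique_M: "R_fun_eq R M \<Longrightarrow> R_fun_eq R M' \<Longrightarrow> M = M'"
  using R_fun_eq_fps_inv[of R M] R_fun_eq_fps_inv[of R M'] by (metis fps_X_neq_zero mult_left_cancel)

lemma ex_M_eq:
  fixes R :: "real fps"
  assumes "R $ 0 = 0" shows "\<exists>M. R_fun_eq R M"
proof -
  define K where "K = fps_X * inverse (1 + R)"
  define M where "M = fps_shift 1 (fps_inv K)"
  have K: "K $ 0 = 0" "K $ 1 = 1" using assms by (simp_all add: K_def fps_mult_nth_1)
  have W: "fps_inv K = fps_X * M"
    by (rule fps_ext) (auto simp: M_def fps_inv_def)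
  have M0: "M $ 0 = 1"
    using K by (simp add: M_def fps_inv_def)
  have "fps_X = K oo (fps_X * M)" using K fps_inv_right[of K] W by simp
  also have "\<dots> = (fps_X * M) * inverse (1 + (R oo fps_X * M))"
    using assms by (simp add: K_def fps_compose_mult_distrib fps_inverse_compose fps_compose_add_distrib)
  finally have "fps_X * (1 + (R oo fps_X * M)) = (fps_X * M) * (inverse (1 + (R oo fps_X * M)) * (1 + (R oo fps_X * M)))"
    by (metis mult.assoc)
  then have "fps_X * (1 + (R oo fps_X * M)) = fps_X * M"
    using assms by (simp add: inverse_mult_eq_1)
  then have "1 + (R oo fps_X * M) = M" by simp
  with M0 show ?thesis by (auto simp: R_fun_eq_def add.commute)
qed

lemma R_transform_eqI:
  assumes "R_fun_eq R (moment_fps \<mu>)" shows "R_transform \<mu> = R"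
  unfolding R_transform_def
proof (rule the_equality)
  show "(R oo fps_X * moment_fps \<mu>) + 1 = moment_fps \<mu>" using assms by (simp add: R_fun_eq_def)
  show "R' = R" if "(R' oo fps_X * moment_fps \<mu>) + 1 = moment_fps \<mu>" for R'
    using that assms by (intro R_fun_eq_unique_R[of _ "moment_fps \<mu>"]) (auto simp: R_fun_eq_def)
qed

text \<open>Only coefficients of \<open>M\<close> of index at most \<open>m\<close> occur on the
  right: this is the moment-cumulant recursion, and it contains no minus signs.\<close>

lemma R_fun_eq_nth_Suc:
  assumes "R_fun_eq R M"
  shows "M $ Suc m = (\<Sum>i\<in>{1..Suc m}. R $ i * (M ^ i) $ (Suc m - i))"
proof -
  have "M = (R oo (fps_X * M)) + 1" using assms by (simp add: R_fun_eq_def)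
  then have "M $ Suc m = (R oo (fps_X * M)) $ Suc m" by (metis add_cancel_right_right fps_add_nth fps_one_nth nat.distinct(1))
  also have "\<dots> = (\<Sum>i=0..Suc m. R $ i * ((fps_X * M) ^ i) $ (Suc m))"
    by (rule fps_compose_nth)
  also have "\<dots> = (\<Sum>i=0..Suc m. R $ i * (M ^ i) $ (Suc m - i))"
    by (intro sum.cong) (auto simp: power_mult_distrib fps_X_power_mult_nth)
  also have "\<dots> = (\<Sum>i\<in>{1..Suc m}. R $ i * (M ^ i) $ (Suc m - i))"
    using R_fun_eq_nth_0[OF assms] by (intro sum.mono_neutral_right) (auto simp: not_less_eq_eq)
  finally show ?thesis .
qed

text \<open>The hypothesis stops at \<open>k\<close> because the strong induction in
  \<open>R_fun_eq_mono\<close> knows only the earlier coefficients.\<close>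

lemma fps_power_nth_mono:
  fixes f g :: "real fps"
  assumes "\<And>j. j \<le> k \<Longrightarrow> 0 \<le> f $ j \<and> f $ j \<le> g $ j"
  shows "j \<le> k \<Longrightarrow> 0 \<le> (f ^ i) $ j \<and> (f ^ i) $ j \<le> (g ^ i) $ j"
proof (induction i arbitrary: j)
  case (Suc i)
  have "0 \<le> f $ l * (f ^ i) $ (j - l) \<and> f $ l * (f ^ i) $ (j - l) \<le> g $ l * (g ^ i) $ (j - l)" if "l \<le> j" for l
    using Suc.IH[of "j - l"] assms[of l] that Suc.prems
    by (auto intro!: mult_mono mult_nonneg_nonneg)
  then show ?case by (auto simp: fps_mult_nth intro!: sum_nonneg sum_mono)
qed simp

lemma R_fun_eq_mono:
  assumes "R_fun_eq R M" "R_fun_eq R' M'" "\<And>n. 0 \<le> R $ n" "\<And>n. R $ n \<le> R' $ n"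
  shows "0 \<le> M $ n \<and> M $ n \<le> M' $ n"
proof (induction n rule: less_induct)
  case (less n)
  show ?case
  proof (cases n)
    case 0 then show ?thesis using assms by (simp add: R_fun_eq_def)
  next
    case (Suc m)
    have "0 \<le> R $ i * (M ^ i) $ (Suc m - i) \<and> R $ i * (M ^ i) $ (Suc m - i) \<le> R' $ i * (M' ^ i) $ (Suc m - i)"
      if "i \<in> {1..Suc m}" for i
    proof -
      have "0 \<le> (M ^ i) $ (Suc m - i) \<and> (M ^ i) $ (Suc m - i) \<le> (M' ^ i) $ (Suc m - i)"
        using less that Suc by (intro fps_power_nth_mono[of m]) auto
      then show ?thesis using assms(3)[of i] assms(4)[of i] by (auto intro!: mult_mono mult_nonneg_nonneg)
    qed
    then show ?thesis
      unfolding Suc R_fun_eq_nth_Suc[OF assms(1)] R_fun_eq_nth_Suc[OF assms(2)]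
      by (intro conjI sum_mono sum_nonneg) blast+
  qed
qed

text \<open>Only the last summand of the recursion is kept; its weight is
  \<open>(M ^ n) $ 0 = 1\<close>. Exponential bounds on moments thus pass to cumulants.\<close>

lemma R_le_moment:
  assumes "R_fun_eq R M" "\<And>n. 0 \<le> R $ n"
  shows "R $ n \<le> M $ n"
proof (cases n)
  case 0 then show ?thesis using assms R_fun_eq_nth_0[OF assms(1)] by (simp add: R_fun_eq_def)
next
  case (Suc m)
  have pos: "0 \<le> (M ^ i) $ j" for i j
    using fps_power_nth_mono[of j M M j i] R_fun_eq_mono[OF assms(1) assms(1) assms(2)] by auto
  have "R $ Suc m * (M ^ Suc m) $ (Suc m - Suc m) \<le> (\<Sum>i\<in>{1..Suc m}. R $ i * (M ^ i) $ (Suc m - i))"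
    using pos assms(2) by (intro member_le_sum mult_nonneg_nonneg) auto
  moreover have "(M ^ Suc m) $ 0 = 1" using assms by (simp add: fps_power_zeroth R_fun_eq_def)
  ultimately show ?thesis by (simp add: Suc R_fun_eq_nth_Suc[OF assms(1)])
qed

text \<open>\<open>S\<close> is a mixture over \<open>t \<sim> \<rho>\<close> of the series \<open>1 / (1 - (a + t)X - X\<^sup>2S)\<close>. Since a Hankel form of
  size \<open>n + 1\<close> of the latter only involves the form of size \<open>n\<close> of \<open>S\<close>, the fixed point equation
  makes \<open>S\<close> positive semidefinite.\<close>

lemma psd_free_levy:
  fixes R M :: "real fps" and \<rho> :: "real measure"
  assumes eq: "R_fun_eq R M" and c: "0 \<le> c"
    and int: "\<And>n. integrable \<rho> (\<lambda>t. t ^ n)"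
    and R: "\<And>n. R $ (n + 2) = c * (\<integral>t. t ^ n \<partial>\<rho>)"
  shows "psd_upto n (fps_nth M)"
proof -
  define a where "a = R $ 1"
  define P where "P = fps_shift 2 R"
  have P: "P $ n = c * (\<integral>t. t ^ n \<partial>\<rho>)" for n
    using R[of n] by (simp add: P_def)
  define W where "W = fps_X * M"
  define S where "S = M * (P oo W)"
  have W0: "W $ 0 = 0" by (simp add: W_def)
  have M0: "M $ 0 = 1" using eq by (simp add: R_fun_eq_def)
  have R_split: "R = fps_const a * fps_X + fps_X\<^sup>2 * P"
  proof (rule fps_ext)
    fix n :: nat
    have "n = 0 \<or> n = 1 \<or> (\<exists>m. n = m + 2)" by presburger
    then consider "n = 0" | "n = 1" | m where "n = m + 2" by blast
    then show "R $ n = (fps_const a * fps_X + fps_X\<^sup>2 * P) $ n"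
      using R_fun_eq_nth_0[OF eq] by cases (auto simp: a_def P_def fps_X_power_mult_nth)
  qed
  have "M = 1 + (R oo W)" using eq by (simp add: R_fun_eq_def W_def add.commute)
  also have "R oo W = fps_const a * W + W\<^sup>2 * (P oo W)"
    using W0 by (subst R_split) (simp add: fps_compose_add_distrib fps_compose_mult_distrib fps_compose_power[symmetric])
  also have "1 + \<dots> = 1 + M * (fps_const a * fps_X + fps_X\<^sup>2 * S)"
    by (simp add: W_def S_def algebra_simps power2_eq_square)
  finally have MS: "M * (1 - fps_const a * fps_X - fps_X\<^sup>2 * S) = 1"
    by (simp add: algebra_simps)
  \<comment> \<open>From \<open>1 / M = 1 - aX - X^2 S\<close> follows
    \<open>1 / (1 / M - tX) = M / (1 - tXM)\<close>: adding \<open>t\<close> to the linear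
    coefficient amounts to a geometric series in \<open>t\<close>.\<close>
  define Q where "Q t = M * inverse (1 - fps_const t * W)" for t
  have Q: "Q t * (1 - fps_const (a + t) * fps_X - fps_X\<^sup>2 * S) = 1" for t
  proof -
    have "M * (1 - fps_const (a + t) * fps_X - fps_X\<^sup>2 * S) = 1 - fps_const t * W"
      using MS by (simp add: W_def algebra_simps flip: fps_const_add)
    then have "Q t * (1 - fps_const (a + t) * fps_X - fps_X\<^sup>2 * S) 
       = inverse (1 - fps_const t * W) * (1 - fps_const t * W)"
      by (simp add: Q_def mult_ac)
    also have "\<dots> = 1" using W0 by (intro inverse_mult_eq_1) simp
    finally show ?thesis .
  qed
  \<comment> \<open>Since \<open>W ^ i\<close> starts in degree \<open>i\<close>, the inner sums may
    all run up to \<open>n\<close>. Each coefficient of \<open>Q t\<close> is then a polynomial in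
    \<open>t\<close>, hence integrable.\<close>
  have compose_nth: "(M * (A oo W)) $ n = (\<Sum>i\<le>n. A $ i * (M * W ^ i) $ n)" for A n
  proof -
    have "(M * (A oo W)) $ n = (\<Sum>l=0..n. \<Sum>i=0..n. M $ l * (A $ i * (W ^ i) $ (n - l)))"
      unfolding fps_mult_nth fps_compose_nth sum_distrib_left
    proof (rule sum.cong[OF refl], rule sum.mono_neutral_left)
      fix l
      show "\<forall>i\<in>{0..n} - {0..n - l}. M $ l * (A $ i * (W ^ i) $ (n - l)) = 0"
        using startsby_zero_power_prefix[OF W0] by auto
    qed auto
    also have "\<dots> = (\<Sum>i=0..n. A $ i * (M * W ^ i) $ n)"
      by (subst sum.swap) (simp add: fps_mult_nth sum_distrib_left mult_ac)
    finally show ?thesis by (simp add: atLeast0AtMost)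
  qed
  have Qn: "Q t $ n = (\<Sum>i\<le>n. t ^ i * (M * W ^ i) $ n)" for t n
  proof -
    have "Q t = M * (Abs_fps (\<lambda>n. t ^ n) oo W)"
      using W0 by (simp add: Q_def fps_inverse_compose fps_compose_sub_distrib fps_compose_mult_distrib
          flip: fps_inverse_geometric)
    then show ?thesis by (simp add: compose_nth)
  qed
  have Qint: "integrable \<rho> (\<lambda>t. Q t $ n)" for n
    unfolding Qn by (intro Bochner_Integration.integrable_sum integrable_mult_left int)
  \<comment> \<open>\<open>P\<close> is \<open>c\<close> times the mixture of
    \<open>1 / (1 - tX)\<close>, so \<open>S = M (P oo W)\<close> is \<open>c\<close> times the
    mixture of the series \<open>Q t\<close>.\<close>
  have Sn: "S $ n = c * (\<integral>t. Q t $ n \<partial>\<rho>)" for n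
    unfolding Qn S_def compose_nth P
    by (subst Bochner_Integration.integral_sum) (simp_all add: int sum_distrib_left mult_ac)
  have psdS: "psd_upto n (fps_nth S)" for n
  proof (induction n)
    case (Suc n)
    show ?case unfolding psd_upto_def
    proof
      fix p :: "nat \<Rightarrow> real"
      have "(\<Sum>i<Suc n. \<Sum>j<Suc n. p i * p j * S $ (i + j)) =
         c * (\<integral>t. (\<Sum>i<Suc n. \<Sum>j<Suc n. p i * p j * Q t $ (i + j)) \<partial>\<rho>)"
        unfolding Sn
        by (simp add: Qint sum_distrib_left mult_ac distrib_left del: sum.lessThan_Suc)
      also have "0 \<le> \<dots>"
        using psd_uptoD[OF psd_upto_fps_jacobi[OF Q Suc]]
        by (intro mult_nonneg_nonneg c Bochner_Integration.integral_nonneg) auto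
      finally show "0 \<le> (\<Sum>i<Suc n. \<Sum>j<Suc n. p i * p j * S $ (i + j))" .
    qed
  qed (simp add: psd_upto_def)
  show ?thesis
    using psd_upto_fps_jacobi[OF MS psdS, of "n - 1"] by (cases n) (simp_all add: psd_upto_def)
qed

section \<open>Compactly supported measures and their moments\<close>

lemma cs_prob_real_distribution: "cs_prob \<mu> \<Longrightarrow> real_distribution \<mu>"
  by (simp add: cs_prob_def real_distribution_def real_distribution_axioms_def)

lemma cs_probI:
  assumes "real_distribution \<mu>" "AE x in \<mu>. \<bar>x\<bar> \<le> K"
  shows "cs_prob \<mu>"
proof -
  interpret real_distribution \<mu> by fact
  have "AE x in \<mu>. x \<notin> UNIV - {-K..K}" using assms(2) by eventually_elim auto
  then have "emeasure \<mu> (UNIV - {-K..K}) = 0"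
    by (subst (asm) AE_iff_measurable[of "UNIV - {-K..K}"]) auto
  then show ?thesis
    using prob_space_axioms unfolding cs_prob_def by (auto intro!: exI[of _ "{-K..K}"])
qed

lemma cs_prob_bounded:
  assumes "cs_prob \<mu>"
  obtains K where "K > 0" "AE x in \<mu>. \<bar>x\<bar> \<le> K"
proof -
  interpret real_distribution \<mu> by (rule cs_prob_real_distribution[OF assms])
  obtain C where C: "compact C" "emeasure \<mu> (UNIV - C) = 0"
    using assms by (auto simp: cs_prob_def)
  then obtain b where b: "\<And>x. x \<in> C \<Longrightarrow> \<bar>x\<bar> \<le> b"
    using compact_imp_bounded[of C] by (auto simp: bounded_iff)
  have "AE x in \<mu>. x \<in> C"
    using C by (intro AE_I[of _ _ "UNIV - C"]) (auto intro: borel_compact)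
  then have "AE x in \<mu>. \<bar>x\<bar> \<le> max b 1" 
    by eventually_elim (use b in fastforce)
  then show ?thesis by (intro that[of "max b 1"]) auto
qed

lemma (in real_distribution) AE_bounded_moments:
  assumes "AE x in M. \<bar>x\<bar> \<le> K"
  shows "integrable M (\<lambda>x. x ^ n)" "integrable M (\<lambda>x. \<bar>x\<bar> ^ n)" "expectation (\<lambda>x. \<bar>x\<bar> ^ n) \<le> K ^ n"
    "\<bar>moment M n\<bar> \<le> K ^ n"
proof -
  have ae: "AE x in M. \<bar>x\<bar> ^ n \<le> K ^ n" using assms by eventually_elim (simp add: power_mono)
  show 1: "integrable M (\<lambda>x. \<bar>x\<bar> ^ n)"
    using ae by (intro integrable_const_bound[of _ "K ^ n"]) (auto simp: power_abs)
  show 2: "integrable M (\<lambda>x. x ^ n)"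
    using ae by (intro integrable_const_bound[of _ "K ^ n"]) (auto simp: power_abs)
  show 3: "expectation (\<lambda>x. \<bar>x\<bar> ^ n) \<le> K ^ n"
    by (rule integral_le_const[OF 1 ae])
  have "\<bar>moment M n\<bar> \<le> expectation (\<lambda>x. \<bar>x\<bar> ^ n)"
    using integral_norm_bound[of M "\<lambda>x. x ^ n"] by (simp add: moment_def power_abs)
  then show "\<bar>moment M n\<bar> \<le> K ^ n" using 3 by simp
qed

lemma cs_prob_integrable_power:
  assumes "cs_prob \<mu>" shows "integrable \<mu> (\<lambda>x. x ^ n)"
proof -
  obtain K where K: "K > 0" "AE x in \<mu>. \<bar>x\<bar> \<le> K" using cs_prob_bounded[OF assms] .
  show ?thesis by (rule real_distribution.AE_bounded_moments(1)[OF cs_prob_real_distribution[OF assms] K(2)])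
qed

lemma cs_prob_moment_0: "cs_prob \<mu> \<Longrightarrow> moment \<mu> 0 = 1"
proof -
  assume "cs_prob \<mu>"
  then interpret real_distribution \<mu> by (rule cs_prob_real_distribution)
  show ?thesis using prob_space by (simp add: moment_def)
qed

text \<open>Compact support bounds the Taylor remainder of the characteristic function by
  \<open>2 (|t| K)^n / n!\<close>; this is what makes the moments determine the measure.\<close>

lemma cs_prob_char_sums:
  assumes "cs_prob \<mu>"
  shows "(\<lambda>n. ((\<i> * t) ^ n / fact n) * complex_of_real (moment \<mu> n)) sums char \<mu> t"
proof -
  interpret real_distribution \<mu> by (rule cs_prob_real_distribution[OF assms])
  obtain K where K: "K > 0" "AE x in \<mu>. \<bar>x\<bar> \<le> K" using cs_prob_bounded[OF assms] .
  note b = AE_bounded_moments[OF K(2)]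
  let ?s = "\<lambda>n. \<Sum>k\<le>n. ((\<i> * t) ^ k / fact k) * complex_of_real (moment \<mu> k)"
  have "cmod (?s n - char \<mu> t) \<le> 2 * ((\<bar>t\<bar> * K) ^ n / fact n)" for n
  proof -
    have "cmod (?s n - char \<mu> t) \<le> (2 * \<bar>t\<bar> ^ n / fact n) * expectation (\<lambda>x. \<bar>x\<bar> ^ n)"
      using char_approx1[of n t] b(1) by (simp add: moment_def norm_minus_commute)
    also have "\<dots> \<le> (2 * \<bar>t\<bar> ^ n / fact n) * K ^ n"
      by (intro mult_left_mono b(3)) auto
    finally show ?thesis by (simp add: power_mult_distrib)
  qed
  moreover have "(\<lambda>n. 2 * ((\<bar>t\<bar> * K) ^ n / fact n)) \<longlonglongrightarrow> 0"
    using summable_LIMSEQ_zero[OF summable_exp[of "\<bar>t\<bar> * K"]]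
    by (intro tendsto_mult_right_zero) (simp add: divide_inverse mult.commute)
  ultimately have "(\<lambda>n. ?s n - char \<mu> t) \<longlonglongrightarrow> 0"
    by (rule Lim_null_comparison[OF always_eventually[OF allI]])
  then show ?thesis
    unfolding sums_def_le using LIM_zero_iff by blast
qed

lemma cs_prob_eqI:
  assumes "cs_prob \<mu>" "cs_prob \<nu>" "moment \<mu> = moment \<nu>"
  shows "\<mu> = \<nu>"
proof (rule Levy_uniqueness)
  show "char \<mu> = char \<nu>"
    by (rule ext, rule sums_unique2[OF cs_prob_char_sums[OF assms(1)] cs_prob_char_sums[OF assms(2), folded assms(3)]])
qed (use assms cs_prob_real_distribution in auto)

lemma cs_prob_R_eq: "cs_prob \<mu> \<Longrightarrow> R_fun_eq (R_transform \<mu>) (moment_fps \<mu>)"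
proof -
  assume "cs_prob \<mu>"
  then obtain R where R: "R_fun_eq R (moment_fps \<mu>)" 
    using ex_R_eq[of "moment_fps \<mu>"] cs_prob_moment_0[of \<mu>] by (auto simp: moment_fps_def)
  with R_transform_eqI[OF R] show ?thesis by simp
qed

lemma cs_prob_R_transform_inj:
  assumes "cs_prob \<mu>" "cs_prob \<nu>" "R_transform \<mu> = R_transform \<nu>"
  shows "\<mu> = \<nu>"
proof (rule cs_prob_eqI[OF assms(1,2)])
  have "moment_fps \<mu> = moment_fps \<nu>"
    by (rule R_fun_eq_unique_M[OF cs_prob_R_eq[OF assms(1), unfolded assms(3)] cs_prob_R_eq[OF assms(2)]])
  then show "moment \<mu> = moment \<nu>" by (simp add: moment_fps_def fps_eq_iff fun_eq_iff)
qed

lemma free_conv_eqI: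
  assumes "cs_prob \<mu>" "R_transform \<mu> = R_transform \<mu>1 + R_transform \<mu>2"
  shows "free_conv \<mu>1 \<mu>2 = \<mu>"
  unfolding free_conv_def
  by (rule the_equality) (use assms cs_prob_R_transform_inj in auto)

lemma cs_prob_return: "cs_prob (return borel c)"
proof (rule cs_probI)
  show "real_distribution (return borel c)"
    by (auto simp: real_distribution_def real_distribution_axioms_def intro!: prob_space_return)
qed (auto simp: AE_return)

lemma moment_return: "moment (return borel c) n = c ^ n"
  unfolding moment_def by (subst integral_return) auto

lemma R_transform_return_0: "R_transform (return borel 0) = 0"
  by (rule R_transform_eqI)
     (simp add: R_fun_eq_def moment_fps_def moment_return fps_eq_iff power_0_left)

text \<open>Connects the formal moment series with integrals that can be evaluated: the geometric
  series is integrated termwise under the bound \<open>(|z| K)^n\<close>.\<close>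

lemma cs_prob_moment_sums:
  assumes \<mu>: "cs_prob \<mu>" and K: "AE x in \<mu>. \<bar>x\<bar> \<le> K" and z: "\<bar>z\<bar> * K < 1"
  shows "(\<lambda>n. moment \<mu> n * z ^ n) sums (\<integral>x. 1 / (1 - z * x) \<partial>\<mu>)"
proof -
  interpret real_distribution \<mu> by (rule cs_prob_real_distribution[OF \<mu>])
  note b = AE_bounded_moments[OF K]
  have "AE x in \<mu>. 0 \<le> K" using K by eventually_elim auto
  then have K0: "0 \<le> K" by simp
  have small: "AE x in \<mu>. \<bar>z * x\<bar> < 1"
    using K
  proof eventually_elim
    case (elim x)
    then have "\<bar>z\<bar> * \<bar>x\<bar> \<le> \<bar>z\<bar> * K" by (intro mult_left_mono) auto
    with z show ?case by (simp add: abs_mult)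
  qed
  have "(\<lambda>n. \<integral>x. (z * x) ^ n \<partial>\<mu>) sums (\<integral>x. (\<Sum>n. (z * x) ^ n) \<partial>\<mu>)"
  proof (rule sums_integral)
    show "integrable \<mu> (\<lambda>x. (z * x) ^ n)" for n using b(1) by (simp add: power_mult_distrib)
    show "AE x in \<mu>. summable (\<lambda>n. norm ((z * x) ^ n))"
      using small by eventually_elim (simp add: power_abs summable_geometric)
    show "summable (\<lambda>n. \<integral>x. norm ((z * x) ^ n) \<partial>\<mu>)"
    proof (rule summable_comparison_test')
      show "summable (\<lambda>n. (\<bar>z\<bar> * K) ^ n)" using z K0 by (intro summable_geometric) simp
      show "norm (\<integral>x. norm ((z * x) ^ n) \<partial>\<mu>) \<le> (\<bar>z\<bar> * K) ^ n" if "n \<ge> 0" for n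
      proof -
        have "(\<integral>x. norm ((z * x) ^ n) \<partial>\<mu>) = \<bar>z\<bar> ^ n * expectation (\<lambda>x. \<bar>x\<bar> ^ n)"
          by (simp only: real_norm_def power_abs[symmetric] abs_mult power_mult_distrib integral_mult_right_zero)
        also have "\<dots> \<le> \<bar>z\<bar> ^ n * K ^ n" by (intro mult_left_mono b(3)) auto
        finally show ?thesis by (simp add: power_mult_distrib integral_nonneg_AE)
      qed
    qed
  qed
  also have "(\<lambda>n. \<integral>x. (z * x) ^ n \<partial>\<mu>) = (\<lambda>n. moment \<mu> n * z ^ n)"
    by (simp add: power_mult_distrib moment_def mult.commute)
  also have "(\<integral>x. (\<Sum>n. (z * x) ^ n) \<partial>\<mu>) = (\<integral>x. 1 / (1 - z * x) \<partial>\<mu>)"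
  proof (rule integral_cong_AE)
    show "AE x in \<mu>. (\<Sum>n. (z * x) ^ n) = 1 / (1 - z * x)"
      using small by eventually_elim (simp add: suminf_geometric)
    show "(\<lambda>x. 1 / (1 - z * x)) \<in> borel_measurable \<mu>" by measurable
    show "(\<lambda>x. \<Sum>n. (z * x) ^ n) \<in> borel_measurable \<mu>" 
      by (intro borel_measurable_suminf) measurable
  qed
  finally show ?thesis .
qed

section \<open>The moment problem for exponentially bounded sequences\<close>

text \<open>The Riesz functional of the sequence; positivity of Hankel forms becomes positivity on
  squares of polynomials.\<close>

definition lin_ext :: "(nat \<Rightarrow> real) \<Rightarrow> real poly \<Rightarrow> real" where
  "lin_ext a p = (\<Sum>i\<le>degree p. coeff p i * a i)"

lemma lin_ext_upto: "degree p \<le> n \<Longrightarrow> lin_ext a p = (\<Sum>i\<le>n. coeff p i * a i)"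
  unfolding lin_ext_def by (rule sum.mono_neutral_left) (auto simp: coeff_eq_0)

lemma lin_ext_add: "lin_ext a (p + q) = lin_ext a p + lin_ext a q"
proof -
  define n where "n = max (degree p) (degree q)"
  have "degree (p + q) \<le> n" "degree p \<le> n" "degree q \<le> n"
    by (auto simp: n_def intro: degree_add_le)
  then show ?thesis by (simp add: lin_ext_upto[of _ n] distrib_right sum.distrib)
qed

lemma lin_ext_smult: "lin_ext a (smult c p) = c * lin_ext a p"
  by (simp add: lin_ext_upto[of "smult c p" "degree p"] lin_ext_upto[of p "degree p"] degree_smult_le
      sum_distrib_left mult_ac)

lemma lin_ext_0 [simp]: "lin_ext a 0 = 0"
  by (simp add: lin_ext_def)

lemma lin_ext_1 [simp]: "lin_ext a 1 = a 0"
  by (simp add: lin_ext_def)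

lemma lin_ext_diff: "lin_ext a (p - q) = lin_ext a p - lin_ext a q"
  using lin_ext_add[of a "p - q" q] by simp

lemma lin_ext_sum: "lin_ext a (sum f A) = (\<Sum>i\<in>A. lin_ext a (f i))"
  by (induction A rule: infinite_finite_induct) (simp_all add: lin_ext_add)

lemma lin_ext_monom: "lin_ext a (monom c n) = c * a n"
  by (simp add: lin_ext_upto[of _ n] degree_monom_le if_distrib[of "\<lambda>x. x * _"] cong: if_cong)

lemma lin_ext_mult:
  "lin_ext a (p * q) = (\<Sum>i\<le>degree p. \<Sum>j\<le>degree q. coeff p i * coeff q j * a (i + j))"
proof -
  have "p * q = (\<Sum>i\<le>degree p. monom (coeff p i) i) * (\<Sum>j\<le>degree q. monom (coeff q j) j)"
    by (simp add: poly_as_sum_of_monoms)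
  also have "\<dots> = (\<Sum>i\<le>degree p. \<Sum>j\<le>degree q. monom (coeff p i * coeff q j) (i + j))"
    by (simp add: sum_product mult_monom)
  finally show ?thesis by (simp add: lin_ext_sum lin_ext_monom)
qed

lemma lin_ext_monom_mult: "lin_ext a (monom 1 k * p) = (\<Sum>i\<le>degree p. coeff p i * a (k + i))"
  by (simp add: lin_ext_mult[of a p "monom 1 k"] mult.commute[of "monom 1 k"] degree_monom_eq
      if_distrib[of "\<lambda>x. _ * x"] if_distrib[of "\<lambda>x. x * _"] add.commute cong: if_cong)

section \<open>Discriminants and log-convex sequences\<close>

lemma quadratic_nonneg_discriminant:
  fixes A B C :: real
  assumes "\<And>s. 0 \<le> A * s\<^sup>2 + 2 * B * s + C"
  shows "B\<^sup>2 \<le> A * C"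
proof (cases "A = 0")
  case True
  have "B = 0"
  proof (rule ccontr)
    assume "B \<noteq> 0"
    \<comment> \<open>At this point \<open>2 B s + C\<close> equals \<open>-1\<close>.\<close>
    with assms[of "- (C + 1) / (2 * B)"] True show False by (simp add: field_simps)
  qed
  then show ?thesis by (simp add: True)
next
  case False
  have "A \<ge> 0"
  proof (rule ccontr)
    assume "\<not> A \<ge> 0"
    \<comment> \<open>\<open>s \<ge> 1\<close> allows \<open>C\<close> to be bounded by
      \<open>|C| s\<close>; the other entry makes the negative quadratic term dominate.\<close>
    define s where "s = max 1 ((2 * \<bar>B\<bar> + \<bar>C\<bar> + 1) / (- A))"
    have s: "s \<ge> 1" "(- A) * s \<ge> 2 * \<bar>B\<bar> + \<bar>C\<bar> + 1"
      using \<open>\<not> A \<ge> 0\<close> by (auto simp: s_def field_simps max_def not_le)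
    have "A * s\<^sup>2 + 2 * B * s + C \<le> A * s\<^sup>2 + 2 * \<bar>B\<bar> * s + \<bar>C\<bar> * s"
      using s(1) mult_right_mono[of "2 * B" "2 * \<bar>B\<bar>" s] mult_left_mono[of 1 s "\<bar>C\<bar>"] by linarith
    also have "\<dots> = s * (2 * \<bar>B\<bar> + \<bar>C\<bar> - (- A) * s)" by (simp add: algebra_simps power2_eq_square)
    also have "\<dots> < 0" using s by (intro mult_pos_neg) auto
    finally show False using assms[of s] by simp
  qed
  with False have "A > 0" by simp
  then show ?thesis
    using assms[of "- B / A"] by (simp add: field_simps power2_eq_square)
qed

text \<open>The ratios \<open>b (k + 1) / b k\<close> of a log-convex sequence do not decrease
  (\<open>step\<close>, cross-multiplied). A first ratio above \<open>q\<close> would therefore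
  force growth faster than \<open>q ^ k\<close>.\<close>

lemma log_convex_first_ratio:
  fixes b :: "nat \<Rightarrow> real"
  assumes nn: "\<And>k. 0 \<le> b k" and lc: "\<And>k. (b (k + 1))\<^sup>2 \<le> b k * b (k + 2)"
    and q: "q > 0" and le: "\<And>k. b k \<le> C * q ^ k"
  shows "b 1 \<le> q * b 0"
proof (rule ccontr)
  assume "\<not> b 1 \<le> q * b 0"
  then have gt: "b 1 > q * b 0" by simp
  then have b1: "b 1 > 0" using nn[of 0] q by (meson mult_nonneg_nonneg less_imp_le order_le_less_trans)
  have b0: "b 0 > 0"
  proof (rule ccontr)
    assume "\<not> b 0 > 0"
    then have "b 0 = 0" using nn[of 0] by simp
    then show False using lc[of 0] b1 by simp
  qed
  have step: "b k > 0 \<and> b 1 * b k \<le> b (k + 1) * b 0" for k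
  proof (induction k)
    case (Suc k)
    have pos: "b (k + 1) > 0"
      using Suc b1 b0 by (smt (verit, best) mult_pos_pos zero_less_mult_pos2)
    have "b k * (b 1 * b (k + 1)) \<le> (b (k + 1) * b 0) * b (k + 1)"
      using Suc pos by (simp add: mult_ac mult_left_mono)
    also have "\<dots> \<le> b k * b (k + 2) * b 0"
      using mult_right_mono[OF lc[of k], of "b 0"] b0 by (simp add: power2_eq_square mult_ac)
    finally have "b k * (b 1 * b (k + 1)) \<le> b k * (b (k + 2) * b 0)" by (simp add: mult_ac)
    then have "b 1 * b (k + 1) \<le> b (k + 2) * b 0"
      using Suc by (simp add: mult_le_cancel_left)
    with pos show ?case by simp
  qed (use b0 in simp)
  define r where "r = b 1 / (q * b 0)"
  have r: "r > 1" using gt b0 q by (simp add: r_def)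
  have rr: "r * q * b 0 = b 1" using b0 q by (simp add: r_def)
  have grow: "b 0 * (r * q) ^ k \<le> b k" for k
  proof (induction k)
    case (Suc k)
    have "b 0 * (b 0 * (r * q) ^ Suc k) = b 1 * (b 0 * (r * q) ^ k)"
      unfolding rr[symmetric] by (simp add: mult_ac)
    also have "\<dots> \<le> b 1 * b k" using Suc b1 by (simp add: mult_left_mono)
    also have "\<dots> \<le> b 0 * b (Suc k)" using step[of k] by (simp add: mult.commute)
    finally show ?case using b0 by simp
  qed simp
  obtain k where k: "C / b 0 < r ^ k" using real_arch_pow[OF r] by blast
  have "b 0 * r ^ k * q ^ k \<le> C * q ^ k"
    using order_trans[OF grow le, of k] by (simp add: power_mult_distrib mult_ac)
  then have "b 0 * r ^ k \<le> C" using q by simp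
  with k b0 show False by (simp add: field_simps)
qed

section \<open>Binomial moments of Bernstein weights\<close>

lemma abs_binomial_ratio_minus_power_le:
  assumes "k \<le> n" "m \<le> n" "n > 0"
  shows "\<bar>real (k choose m) / real (n choose m) - (real k / real n) ^ m\<bar> \<le> real m * real m / real n"
proof -
  have "real (k choose m) / real (n choose m) = (\<Prod>i<m. real (k - i) / real (n - i))"
  proof (cases "m \<le> k")
    case True
    have "real (k choose m) / real (n choose m)
       = (\<Prod>i=0..<m. (real (k - i) / real (m - i)) / (real (n - i) / real (m - i)))"
      using True assms by (simp only: binomial_altdef_of_nat prod_dividef)
    also have "\<dots> = (\<Prod>i<m. real (k - i) / real (n - i))"
      unfolding lessThan_atLeast0 by (intro prod.cong) auto
    finally show ?thesis .
  next
    case False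
    then have "(\<Prod>i<m. real (k - i) / real (n - i)) = 0"
      by (intro prod_zero bexI[of _ k]) auto
    with False show ?thesis by (simp add: binomial_eq_0)
  qed
  moreover have "(real k / real n) ^ m = (\<Prod>i<m. real k / real n)" by simp
  \<comment> \<open>A difference of products with factors in \<open>[0, 1]\<close> is at most the
    sum of the factor differences; each of the \<open>m\<close> factors contributes at most
    \<open>m / n\<close>.\<close>
  moreover have "\<bar>(\<Prod>i<m. real (k - i) / real (n - i)) - (\<Prod>i<m. real k / real n)\<bar>
      \<le> (\<Sum>i<m. \<bar>real (k - i) / real (n - i) - real k / real n\<bar>)"
    using norm_prod_diff[of "{..<m}" "\<lambda>i. real (k - i) / real (n - i)" "\<lambda>_. real k / real n"] assms
    by (auto simp: divide_le_eq_1)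
  moreover have "\<dots> \<le> (\<Sum>i<m. real m / real n)"
  proof (rule sum_mono)
    fix i assume i: "i \<in> {..<m}"
    show "\<bar>real (k - i) / real (n - i) - real k / real n\<bar> \<le> real m / real n"
    proof (cases "i \<le> k")
      case True
      have n: "real (n - i) > 0" "real n > 0" using i assms by auto
      have "real k / real n - real (k - i) / real (n - i) = (real i / real n) * (real (n - k) / real (n - i))"
        using True i assms n by (simp add: of_nat_diff field_simps)
      moreover have "0 \<le> real (n - k) / real (n - i)" "real (n - k) / real (n - i) \<le> 1"
        using True n by (auto simp: divide_le_eq_1)
      ultimately have "\<bar>real (k - i) / real (n - i) - real k / real n\<bar> \<le> real i / real n"
        using mult_left_mono[of "real (n - k) / real (n - i)" 1 "real i / real n"]
        by (simp add: abs_minus_commute[of "real (k - i) / real (n - i)"])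
      also have "\<dots> \<le> real m / real n" using i by (intro divide_right_mono) auto
      finally show ?thesis .
    next
      \<comment> \<open>Here \<open>k - i\<close> is truncated to \<open>0\<close>, and the
        remaining \<open>k / n\<close> is below \<open>m / n\<close> because
        \<open>k < i < m\<close>.\<close>
      case False
      then show ?thesis using i by (auto intro!: divide_right_mono)
    qed
  qed
  ultimately show ?thesis by simp
qed

text \<open>\<open>choose_mult\<close> pulls out \<open>(n choose m) u^m\<close>; what is left is
  the expansion of \<open>(u + v)^(n - m) = 1\<close>. The ring is general because \<open>u\<close>
  and \<open>v\<close> will be polynomials.\<close>

lemma bernstein_binomial_moment:
  fixes u v :: "'a::comm_ring_1"
  assumes uv: "u + v = 1" and m: "m \<le> n"
  shows "(\<Sum>k\<le>n. of_nat (k choose m) * (of_nat (n choose k) * u ^ k * v ^ (n - k))) = of_nat (n choose m) * u ^ m"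
proof -
  have "(\<Sum>k\<le>n. of_nat (k choose m) * (of_nat (n choose k) * u ^ k * v ^ (n - k)))
     = (\<Sum>k\<in>{m..n}. of_nat (k choose m) * (of_nat (n choose k) * u ^ k * v ^ (n - k)))"
    by (intro sum.mono_neutral_right) (auto simp: binomial_eq_0)
  also have "\<dots> = (\<Sum>j\<le>n - m. of_nat (n choose m) * u ^ m * (of_nat (n - m choose j) * u ^ j * v ^ (n - m - j)))"
  proof (rule sum.reindex_bij_witness[of _ "\<lambda>j. j + m" "\<lambda>k. k - m"])
    fix k assume k: "k \<in> {m..n}"
    then have "(n choose k) * (k choose m) = (n choose m) * (n - m choose (k - m))"
      by (intro choose_mult) auto
    then have "of_nat (k choose m) * of_nat (n choose k) = (of_nat (n choose m) * of_nat (n - m choose (k - m)) :: 'a)"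
      by (metis mult.commute of_nat_mult)
    moreover have "u ^ k = u ^ m * u ^ (k - m)" using k by (simp flip: power_add)
    moreover have "n - m - (k - m) = n - k" using k by auto
    ultimately show "of_nat (n choose m) * u ^ m * (of_nat (n - m choose (k - m)) * u ^ (k - m) * v ^ (n - m - (k - m)))
       = of_nat (k choose m) * (of_nat (n choose k) * u ^ k * v ^ (n - k))"
      by (simp add: mult_ac) (simp add: mult.assoc[symmetric])
  qed (use m in auto)
  also have "\<dots> = of_nat (n choose m) * u ^ m * (u + v) ^ (n - m)"
    by (simp add: binomial_ring sum_distrib_left)
  finally show ?thesis by (simp add: uv)
qed

section \<open>Positivity of the functional on the interval\<close>

lemma lin_ext_square_nonneg:
  assumes "\<And>n. psd_upto n a"
  shows "0 \<le> lin_ext a (p * p)"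
  using psd_uptoD[OF assms, where n = "Suc (degree p)" and p = "coeff p"]
  by (simp add: lin_ext_mult lessThan_Suc_atMost)

lemma lin_ext_Cauchy_Schwarz:
  assumes "\<And>n. psd_upto n a"
  shows "(lin_ext a (p * q))\<^sup>2 \<le> lin_ext a (p * p) * lin_ext a (q * q)"
proof (rule quadratic_nonneg_discriminant)
  fix s
  have "(smult s p + q) * (smult s p + q) = smult (s\<^sup>2) (p * p) + smult (2 * s) (p * q) + q * q"
    unfolding poly_eq_poly_eq_iff[symmetric] by (simp add: fun_eq_iff algebra_simps power2_eq_square)
  then show "0 \<le> lin_ext a (p * p) * s\<^sup>2 + 2 * lin_ext a (p * q) * s + lin_ext a (q * q)"
    using lin_ext_square_nonneg[OF assms, of "smult s p + q"]
    by (simp add: lin_ext_add lin_ext_smult mult_ac)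
qed

text \<open>Writing \<open>L\<close> for the functional, Cauchy-Schwarz makes
  \<open>b k = L(x^(2k) p^2)\<close> log-convex, and it grows at most like \<open>B^(2k)\<close>.
  Its first ratio is thus at most \<open>B^2\<close>, that is
  \<open>L(x^2 p^2) \<le> B^2 L(p^2)\<close>: growth of the sequence confines the support.\<close>

lemma lin_ext_interval_nonneg:
  assumes psd: "\<And>n. psd_upto n a" and B: "B > 0" and bd: "\<And>n. \<bar>a n\<bar> \<le> C * B ^ n"
  shows "0 \<le> lin_ext a (([:B\<^sup>2:] - monom 1 2) * (p * p))"
proof -
  define b where "b k = lin_ext a ((monom 1 k * p) * (monom 1 k * p))" for k
  have b: "b k = lin_ext a (monom 1 (2 * k) * (p * p))" for k
    by (simp add: b_def mult_ac mult_monom mult_2 mult_2_right flip: mult.assoc)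
  have "(b (k + 1))\<^sup>2 \<le> b k * b (k + 2)" for k
  proof -
    have "b (k + 1) = lin_ext a ((monom 1 k * p) * (monom 1 (k + 2) * p))"
      by (simp add: b_def mult_ac mult_monom flip: mult.assoc)
    then show ?thesis unfolding b_def by (simp only: lin_ext_Cauchy_Schwarz[OF psd])
  qed
  moreover have "b k \<le> (\<Sum>i\<le>degree (p * p). \<bar>coeff (p * p) i\<bar> * C * B ^ i) * (B\<^sup>2) ^ k" for k
  proof -
    have "b k \<le> (\<Sum>i\<le>degree (p * p). \<bar>coeff (p * p) i * a (2 * k + i)\<bar>)"
      unfolding b lin_ext_monom_mult by (intro sum_mono) simp
    also have "\<dots> \<le> (\<Sum>i\<le>degree (p * p). \<bar>coeff (p * p) i\<bar> * (C * B ^ (2 * k + i)))"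
      unfolding abs_mult by (intro sum_mono mult_left_mono bd) simp
    also have "\<dots> = (\<Sum>i\<le>degree (p * p). \<bar>coeff (p * p) i\<bar> * C * B ^ i) * (B\<^sup>2) ^ k"
    proof -
      have "B ^ (2 * k + i) = B ^ i * (B\<^sup>2) ^ k" for i
        unfolding power_add power_mult by (rule mult.commute)
      then show ?thesis by (simp add: sum_distrib_left mult_ac)
    qed
    finally show ?thesis .
  qed
  ultimately have "b 1 \<le> B\<^sup>2 * b 0"
    using lin_ext_square_nonneg[OF psd] B by (intro log_convex_first_ratio) (auto simp: b_def)
  moreover have "([:B\<^sup>2:] - monom 1 2) * (p * p) = smult (B\<^sup>2) (p * p) - monom 1 (2 * 1) * (p * p)"
    by (simp add: left_diff_distrib)
  ultimately show ?thesis by (simp add: b lin_ext_diff lin_ext_smult)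
qed

text \<open>With \<open>u = B + x\<close> and \<open>v = B - x\<close>, a square \<open>p^2\<close>
  splits off according to the parities of the exponents. The leftover \<open>u v\<close> is
  \<open>lin_ext_interval_nonneg\<close>; for a single factor,
  \<open>2 B u p^2 = (u p)^2 + u v p^2\<close> because \<open>2 B = u + v\<close>.\<close>

lemma lin_ext_bernstein_nonneg:
  assumes psd: "\<And>n. psd_upto n a" and B: "B > 0" and bd: "\<And>n. \<bar>a n\<bar> \<le> C * B ^ n"
  shows "0 \<le> lin_ext a ([:B, 1:] ^ i * [:B, -1:] ^ j)"
proof -
  define u v where "u = [:B, 1:]" and "v = [:B, -1:]"
  have sq: "0 \<le> lin_ext a (p * p)" for p
    by (rule lin_ext_square_nonneg[OF psd])
  have uv: "u * v = [:B\<^sup>2:] - monom 1 2" 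
    by (simp add: u_def v_def monom_altdef numeral_2_eq_2)
  have int: "0 \<le> lin_ext a (u * v * (p * p))" for p
    using lin_ext_interval_nonneg[OF psd B bd, of p] by (simp only: uv)
  have c: "smult (2 * B) r = u * r + v * r" for r
  proof -
    have "smult (2 * B) r = [:2 * B:] * r" by simp
    also have "[:2 * B:] = u + v" by (simp add: u_def v_def)
    finally show ?thesis by (simp only: distrib_right)
  qed
  have uv_half: "0 \<le> lin_ext a (u * (p * p)) \<and> 0 \<le> lin_ext a (v * (p * p))" for p
  proof -
    have "smult (2 * B) (u * (p * p)) = (u * p) * (u * p) + u * v * (p * p)"
      "smult (2 * B) (v * (p * p)) = (v * p) * (v * p) + u * v * (p * p)"
      unfolding c by (simp_all only: mult_ac add_ac)
    then have "2 * B * lin_ext a (u * (p * p)) \<ge> 0" "2 * B * lin_ext a (v * (p * p)) \<ge> 0"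
      using sq[of "u * p"] sq[of "v * p"] int[of p] by (simp_all only: lin_ext_smult[symmetric] lin_ext_add add_nonneg_nonneg)
    then show ?thesis using B by (simp add: zero_le_mult_iff)
  qed
  have parity: "\<exists>k. l = k + k \<or> l = Suc (k + k)" for l :: nat by presburger
  obtain i' where i: "i = i' + i' \<or> i = Suc (i' + i')" using parity by blast
  obtain j' where j: "j = j' + j' \<or> j = Suc (j' + j')" using parity by blast
  define p where "p = u ^ i' * v ^ j'"
  have "u ^ (i' + i') * v ^ (j' + j') = p * p"
    "u ^ (Suc (i' + i')) * v ^ (j' + j') = u * (p * p)"
    "u ^ (i' + i') * v ^ (Suc (j' + j')) = v * (p * p)"
    "u ^ (Suc (i' + i')) * v ^ (Suc (j' + j')) = u * v * (p * p)"
    by (simp_all only: p_def power_add power_Suc mult_ac)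
  then have "0 \<le> lin_ext a (u ^ i * v ^ j)"
    using i j sq[of p] int[of p] uv_half[of p, THEN conjunct1] uv_half[of p, THEN conjunct2]
    by (elim disjE) (simp_all only:)
  then show ?thesis by (simp add: u_def v_def)
qed

section \<open>From Bernstein weights to a measure\<close>

lemma ex_finite_pmf:
  fixes w :: "nat \<Rightarrow> real"
  assumes "\<And>k. k \<le> n \<Longrightarrow> 0 \<le> w k" "(\<Sum>k\<le>n. w k) = 1"
  obtains P where "set_pmf P \<subseteq> {..n}" "\<And>k. k \<le> n \<Longrightarrow> pmf P k = w k"
proof -
  define f where "f k = (if k \<le> n then w k else 0)" for k
  have nn: "\<And>k. 0 \<le> f k" using assms by (simp add: f_def)
  have "(\<integral>\<^sup>+ k. ennreal (f k) \<partial>count_space UNIV) = (\<Sum>k\<le>n. ennreal (f k))"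
    by (rule nn_integral_count_space'[of "{..n}"]) (auto simp: f_def)
  also have "\<dots> = ennreal (\<Sum>k\<le>n. w k)"
    using assms(1) by (subst sum_ennreal[symmetric]) (auto simp: f_def intro!: sum.cong)
  finally have "(\<integral>\<^sup>+ k. ennreal (f k) \<partial>count_space UNIV) = 1" by (simp add: assms)
  then have "pmf (embed_pmf f) k = f k" for k using nn by (intro pmf_embed_pmf)
  then show ?thesis by (intro that[of "embed_pmf f"]) (auto simp: set_pmf_eq f_def split: if_splits)
qed

text \<open>A limit of the Bernstein discretisations \<open>\<Sum>k\<le>n. w n k \<delta>(k/n)\<close>, extracted with Helly's theorem.\<close>

lemma hausdorff_moment:
  fixes w :: "nat \<Rightarrow> nat \<Rightarrow> real" and c :: "nat \<Rightarrow> real"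
  assumes nn: "\<And>n k. k \<le> n \<Longrightarrow> 0 \<le> w n k"
    and w: "\<And>n m. m \<le> n \<Longrightarrow> (\<Sum>k\<le>n. real (k choose m) * w n k) = real (n choose m) * c m"
    and c0: "c 0 = 1"
  shows "\<exists>M. real_distribution M \<and> (AE x in M. 0 \<le> x \<and> x \<le> 1) \<and> (\<forall>m. moment M m = c m)"
proof -
  have sum1: "(\<Sum>k\<le>n. w n k) = 1" for n using w[of 0 n] c0 by simp
  have "\<forall>n. \<exists>P. set_pmf P \<subseteq> {..n} \<and> (\<forall>k\<le>n. pmf P k = w n k)"
    using ex_finite_pmf[OF nn sum1] by metis
  then obtain P where P: "\<And>n. set_pmf (P n) \<subseteq> {..n}" "\<And>n k. k \<le> n \<Longrightarrow> pmf (P n) k = w n k"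
    by metis
  \<comment> \<open>For \<open>n = 0\<close> the quotient is \<open>0\<close> by convention, so this
    is still a law on the unit interval.\<close>
  define \<mu> where "\<mu> n = distr (measure_pmf (P n)) borel (\<lambda>k. real k / real n)" for n
  have rd: "real_distribution (\<mu> n)" for n
    unfolding \<mu>_def by (intro prob_space.real_distribution_distr prob_space_measure_pmf) simp
  have int_\<mu>: "(\<integral>x. f x \<partial>\<mu> n) = (\<Sum>k\<le>n. f (real k / real n) * w n k)" 
    if "f \<in> borel_measurable borel" for f :: "real \<Rightarrow> real" and n
  proof -
    have "(\<integral>x. f x \<partial>\<mu> n) = (\<integral>k. f (real k / real n) \<partial>measure_pmf (P n))"
      unfolding \<mu>_def using that by (subst integral_distr) auto
    also have "\<dots> = (\<Sum>k\<le>n. f (real k / real n) * pmf (P n) k)"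
      using P(1) by (intro integral_measure_pmf_real) auto
    finally show ?thesis using P(2) by simp
  qed
  have frac: "0 \<le> real k / real n" "real k / real n \<le> 1" if "k \<le> n" for k n
    using that by (auto simp: divide_le_eq_1)
  have "tight \<mu>"
    unfolding tight_def
  proof (intro conjI allI impI)
    fix e :: real assume "e > 0"
    \<comment> \<open>Tightness uses left-open intervals; the end \<open>-1\<close> keeps the point
      \<open>0\<close> inside.\<close>
    have "measure (\<mu> n) {-1<..1} = 1" for n
    proof -
      interpret real_distribution "\<mu> n" by (rule rd)
      have "AE x in \<mu> n. x \<in> {-1<..1}"
        unfolding \<mu>_def using P(1)[of n] frac[of _ n]
        by (subst AE_distr_iff) (auto simp: AE_measure_pmf_iff intro: order_less_le_trans[of _ 0])
      then show ?thesis by (subst prob_eq_1) auto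
    qed
    with \<open>e > 0\<close> show "\<exists>a b. a < b \<and> (\<forall>n. 1 - e < measure (\<mu> n) {a<..b})"
      by (intro exI[of _ "-1"] exI[of _ 1]) auto
  qed (rule rd)
  from tight_imp_convergent_subsubsequence[OF this strict_mono_id]
  obtain r M where r: "strict_mono r" and M: "real_distribution M" "weak_conv_m (\<mu> \<circ> r) M" by auto
  interpret M: real_distribution M by fact
  \<comment> \<open>Weak convergence tests bounded continuous functions only; clamping makes
    \<open>x ^ m\<close> bounded without changing integrals over the unit interval.\<close>
  define cl :: "real \<Rightarrow> real" where "cl x = max 0 (min 1 x)" for x
  have cl: "cl (real k / real n) = real k / real n" if "k \<le> n" for k n
    using frac[OF that] by (simp add: cl_def)
  have lim: "(\<lambda>n. \<integral>x. f x \<partial>\<mu> (r n)) \<longlonglongrightarrow> (\<integral>x. f x \<partial>M)"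
    if "\<And>x. isCont f x" "\<And>x. \<bar>f x\<bar> \<le> bd" for f :: "real \<Rightarrow> real" and bd :: real
    using weak_conv_imp_integral_bdd_continuous_conv[of "\<mu> \<circ> r" M f, OF _ M that(1)] rd that(2)
    by (auto simp: o_def)
  have isCont_cl: "isCont cl x" for x
    unfolding cl_def by (intro continuous_intros)
  have cl_meas [measurable]: "cl \<in> borel_measurable borel" unfolding cl_def by measurable
  \<comment> \<open>\<open>g\<close> vanishes exactly on the unit interval, so a zero integral
    forces the limit law to live there; the cap \<open>1\<close> keeps it bounded.\<close>
  define g where "g x = min 1 \<bar>x - cl x\<bar>" for x :: real
  have [measurable]: "g \<in> borel_measurable borel" unfolding g_def by measurable
  have "isCont g x" for x
    unfolding g_def by (intro continuous_intros isCont_cl)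
  moreover have "\<bar>g x\<bar> \<le> 1" for x by (simp add: g_def)
  ultimately have "(\<lambda>n. \<integral>x. g x \<partial>\<mu> (r n)) \<longlonglongrightarrow> (\<integral>x. g x \<partial>M)"
    by (rule lim)
  moreover have "(\<integral>x. g x \<partial>\<mu> (r n)) = 0" for n
    by (subst int_\<mu>) (auto simp: g_def cl intro!: sum.neutral)
  ultimately have "(\<integral>x. g x \<partial>M) = 0" using LIMSEQ_unique[OF _ tendsto_const] by fastforce
  moreover have "integrable M g"
    by (rule M.integrable_const_bound[of _ 1]) (auto simp: g_def)
  ultimately have "AE x in M. g x = 0"
    by (subst (asm) integral_nonneg_eq_0_iff_AE) (auto simp: g_def)
  then have AE: "AE x in M. 0 \<le> x \<and> x \<le> 1"
    by eventually_elim (auto simp: g_def cl_def min_def max_def split: if_splits)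
  have mom: "moment M m = c m" for m
  proof -
    have isC: "isCont (\<lambda>x. cl x ^ m) x" for x by (intro continuous_intros isCont_cl)
    have "\<bar>cl x ^ m\<bar> \<le> 1" for x by (auto simp: cl_def power_abs intro!: power_le_one)
    then have "(\<lambda>n. \<integral>x. cl x ^ m \<partial>\<mu> (r n)) \<longlonglongrightarrow> (\<integral>x. cl x ^ m \<partial>M)"
      using isC by (intro lim)
    moreover have "(\<integral>x. cl x ^ m \<partial>M) = moment M m"
    proof -
      have "AE x in M. cl x ^ m = x ^ m" using AE by eventually_elim (simp add: cl_def)
      then show ?thesis unfolding moment_def by (intro integral_cong_AE) auto
    qed
    \<comment> \<open>The binomial averages equal \<open>c m\<close> exactly; replacing
      \<open>(k choose m) / (n choose m)\<close> by \<open>(k / n) ^ m\<close> costs at most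
      \<open>m^2 / n\<close>.\<close>
    moreover have "(\<lambda>n. \<integral>x. cl x ^ m \<partial>\<mu> n) \<longlonglongrightarrow> c m"
    proof (rule LIM_zero_cancel, rule Lim_null_comparison)
      show "\<forall>\<^sub>F n in sequentially. norm ((\<integral>x. cl x ^ m \<partial>\<mu> n) - c m) \<le> real m * real m / real n"
        using eventually_ge_at_top[of "Suc m"]
      proof eventually_elim
        case (elim n)
        then have n: "m \<le> n" "n > 0" "real (n choose m) > 0" by (auto simp: zero_less_binomial)
        have 1: "(\<integral>x. cl x ^ m \<partial>\<mu> n) = (\<Sum>k\<le>n. (real k / real n) ^ m * w n k)"
          by (subst int_\<mu>) (simp_all add: cl)
        have 2: "c m = (\<Sum>k\<le>n. real (k choose m) / real (n choose m) * w n k)"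
          using w[OF n(1)] n(3) by (simp add: field_simps sum_divide_distrib[symmetric])
        have "\<bar>(\<integral>x. cl x ^ m \<partial>\<mu> n) - c m\<bar> 
           = \<bar>\<Sum>k\<le>n. (real (k choose m) / real (n choose m) - (real k / real n) ^ m) * w n k\<bar>"
          unfolding 1 2 by (subst abs_minus_commute) (simp add: left_diff_distrib sum_subtractf)
        also have "\<dots> \<le> (\<Sum>k\<le>n. \<bar>(real (k choose m) / real (n choose m) - (real k / real n) ^ m) * w n k\<bar>)"
          by (rule sum_abs)
        also have "\<dots> \<le> (\<Sum>k\<le>n. real m * real m / real n * w n k)"
          unfolding abs_mult using nn n
          by (intro sum_mono mult_mono abs_binomial_ratio_minus_power_le) auto
        also have "\<dots> = real m * real m / real n" using sum1[of n] by (simp only: sum_distrib_left[symmetric] mult_1_right)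
        finally show ?case by simp
      qed
      show "(\<lambda>n. real m * real m / real n) \<longlonglongrightarrow> 0" by (rule lim_const_over_n)
    qed
    then have "(\<lambda>n. \<integral>x. cl x ^ m \<partial>\<mu> (r n)) \<longlonglongrightarrow> c m"
      using LIMSEQ_subseq_LIMSEQ[OF _ r] by (auto simp: o_def)
    ultimately show ?thesis using LIMSEQ_unique by metis
  qed
  show ?thesis using M(1) AE mom by blast
qed

lemma pcompose_sum_powers: "pcompose p u = (\<Sum>i\<le>degree p. smult (coeff p i) (u ^ i))"
  for p u :: "real poly"
  unfolding pcompose_altdef poly_altdef
  by (simp add: degree_map_poly coeff_map_poly)

text \<open>The polynomial \<open>u = (B + x) / (2 B)\<close> carries \<open>[-B, B]\<close> to the
  unit interval. Bernstein products of \<open>u\<close> and \<open>1 - u\<close> have nonnegative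
  values under the functional and the binomial moments that \<open>hausdorff_moment\<close>
  requires; the law found there is carried back by \<open>2 B x - B\<close>.\<close>

theorem bounded_hamburger_moment:
  assumes psd: "\<And>n. psd_upto n a" and a0: "a 0 = 1" and B: "B > 0" and bd: "\<And>n. \<bar>a n\<bar> \<le> C * B ^ n"
  shows "\<exists>\<mu>. cs_prob \<mu> \<and> (\<forall>n. moment \<mu> n = a n)"
proof -
  define u v where "u = [:1/2, 1 / (2 * B):]" and "v = [:1/2, - 1 / (2 * B):]"
  have uv: "u + v = 1" by (simp add: u_def v_def one_pCons)
  define w where "w n k = lin_ext a (of_nat (n choose k) * u ^ k * v ^ (n - k))" for n k
  have of_nat_smult: "of_nat m * p = smult (of_nat m) p" for m and p :: "real poly"
    by (simp add: of_nat_poly)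
  have w1: "0 \<le> w n k" if "k \<le> n" for n k
  proof -
    have "u = smult (1 / (2 * B)) [:B, 1:]" "v = smult (1 / (2 * B)) [:B, -1:]"
      using B by (simp_all add: u_def v_def)
    then have "w n k = real (n choose k) * ((1 / (2 * B)) ^ k * (1 / (2 * B)) ^ (n - k) * lin_ext a ([:B, 1:] ^ k * [:B, -1:] ^ (n - k)))"
      by (simp only: w_def of_nat_smult smult_power mult_smult_left mult_smult_right smult_smult lin_ext_smult mult_ac)
    also have "\<dots> \<ge> 0" using B by (intro mult_nonneg_nonneg lin_ext_bernstein_nonneg[OF psd B bd]) auto
    finally show ?thesis .
  qed
  have w2: "(\<Sum>k\<le>n. real (k choose m) * w n k) = real (n choose m) * lin_ext a (u ^ m)" if "m \<le> n" for n m
  proof -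
    have "(\<Sum>k\<le>n. real (k choose m) * w n k)
       = lin_ext a (\<Sum>k\<le>n. of_nat (k choose m) * (of_nat (n choose k) * u ^ k * v ^ (n - k)))"
      by (simp add: w_def lin_ext_sum of_nat_smult lin_ext_smult mult_ac)
    also have "\<dots> = real (n choose m) * lin_ext a (u ^ m)"
      by (subst bernstein_binomial_moment[OF uv that]) (simp add: of_nat_smult lin_ext_smult)
    finally show ?thesis .
  qed
  have w3: "lin_ext a (u ^ 0) = 1" using a0 by simp
  obtain M where M: "real_distribution M" "AE x in M. 0 \<le> x \<and> x \<le> 1"
      "\<And>m. moment M m = lin_ext a (u ^ m)"
    using hausdorff_moment[of w "\<lambda>m. lin_ext a (u ^ m)", OF w1 w2 w3] by auto
  interpret M: real_distribution M by fact
  have AE1: "AE x in M. \<bar>x\<bar> \<le> 1" using M(2) by eventually_elim simp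
  note int = M.AE_bounded_moments(1)[OF AE1]
  have poly: "(\<integral>x. poly p x \<partial>M) = lin_ext a (pcompose p u)" for p
  proof -
    have "(\<integral>x. poly p x \<partial>M) = (\<Sum>i\<le>degree p. coeff p i * moment M i)"
      unfolding poly_altdef moment_def
      by (subst Bochner_Integration.integral_sum) (auto intro!: integrable_mult_right int)
    then show ?thesis by (simp add: pcompose_sum_powers lin_ext_sum lin_ext_smult M(3))
  qed
  define \<mu> where "\<mu> = distr M borel (\<lambda>x. 2 * B * x - B)"
  have "real_distribution \<mu>" unfolding \<mu>_def by (intro M.real_distribution_distr) simp
  moreover have "AE x in \<mu>. \<bar>x\<bar> \<le> B"
  proof -
    have "AE x in M. \<bar>2 * B * x - B\<bar> \<le> B"
      using M(2)
    proof eventually_elim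
      case (elim x)
      have "0 \<le> B * x" "B * x \<le> B * 1" using elim B by (auto intro!: mult_left_mono mult_nonneg_nonneg)
      then show ?case by (simp add: abs_le_iff)
    qed
    then show ?thesis unfolding \<mu>_def by (subst AE_distr_iff) auto
  qed
  ultimately have "cs_prob \<mu>" by (rule cs_probI)
  moreover have "moment \<mu> n = a n" for n
  proof -
    have "moment \<mu> n = (\<integral>x. poly ([:-B, 2 * B:] ^ n) x \<partial>M)"
      unfolding moment_def \<mu>_def poly_power by (subst integral_distr) (auto simp: algebra_simps)
    also have "\<dots> = lin_ext a ((pcompose [:-B, 2 * B:] u) ^ n)"
    proof -
      have "pcompose (p ^ n) u = pcompose p u ^ n" for p
        by (induction n) (simp_all add: pcompose_1 pcompose_mult)
      then show ?thesis by (simp only: poly)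
    qed
    also have "pcompose [:-B, 2 * B:] u = monom 1 1"
      using B by (simp add: u_def pcompose_pCons monom_altdef)
    finally show ?thesis by (simp add: monom_power lin_ext_monom)
  qed
  ultimately show ?thesis by blast
qed

section \<open>A criterion for free infinite divisibility\<close>

text \<open>The moment problem is solved twice. Dividing by the second cumulant gives
  \<open>\<rho>\<close>, the normalised free Levy measure, with growth controlled by
  \<open>R_le_moment\<close>. Then \<open>psd_free_levy\<close> provides positivity of the series
  for \<open>s R\<close>, and \<open>R_fun_eq_mono\<close> provides its growth bound.\<close>

lemma ex_cs_prob_scaled_R:
  assumes \<mu>: "cs_prob \<mu>"
    and pos: "\<And>n. 0 \<le> R_transform \<mu> $ n" and var: "0 < R_transform \<mu> $ 2"
    and psd: "\<And>n. psd_upto n (\<lambda>k. R_transform \<mu> $ (k + 2))"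
    and s: "0 \<le> s" "s \<le> 1"
  shows "\<exists>\<nu>. cs_prob \<nu> \<and> R_transform \<nu> = fps_const s * R_transform \<mu>"
proof -
  define R where "R = R_transform \<mu>"
  have R: "R_fun_eq R (moment_fps \<mu>)" unfolding R_def by (rule cs_prob_R_eq[OF \<mu>])
  obtain K where K: "K > 0" "AE x in \<mu>. \<bar>x\<bar> \<le> K" using cs_prob_bounded[OF \<mu>] .
  have mom: "moment \<mu> n \<le> K ^ n" for n
    using real_distribution.AE_bounded_moments(4)[OF cs_prob_real_distribution[OF \<mu>] K(2), of n] by simp
  have R_le: "R $ n \<le> K ^ n" for n
    using R_le_moment[OF R, of n] pos mom[of n] by (simp add: R_def moment_fps_def)
  have "\<exists>\<rho>. cs_prob \<rho> \<and> (\<forall>n. moment \<rho> n = inverse (R $ 2) * R $ (n + 2))"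
  proof (rule bounded_hamburger_moment)
    show "psd_upto n (\<lambda>n. inverse (R $ 2) * R $ (n + 2))" for n
      using psd var unfolding R_def by (intro psd_upto_scale) auto
    show "inverse (R $ 2) * R $ (0 + 2) = 1" using var by (simp add: R_def numeral_2_eq_2)
    show "\<bar>inverse (R $ 2) * R $ (n + 2)\<bar> \<le> (inverse (R $ 2) * K\<^sup>2) * K ^ n" for n
      using R_le[of "n + 2"] pos[of "n + 2"] var
      by (simp add: R_def abs_mult power_add mult_ac power2_eq_square)
  qed (rule K(1))
  then obtain \<rho> where \<rho>: "cs_prob \<rho>" "\<And>n. moment \<rho> n = inverse (R $ 2) * R $ (n + 2)" by blast
  obtain M where M: "R_fun_eq (fps_const s * R) M"
    using ex_M_eq[of "fps_const s * R"] R_fun_eq_nth_0[OF R] by auto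
  have bounds: "0 \<le> M $ n \<and> M $ n \<le> moment_fps \<mu> $ n" for n
  proof (rule R_fun_eq_mono[OF M R])
    show "0 \<le> (fps_const s * R) $ k" "(fps_const s * R) $ k \<le> R $ k" for k
      using pos[of k] s by (simp_all add: R_def mult_left_le_one_le)
  qed
  have "\<exists>\<nu>. cs_prob \<nu> \<and> (\<forall>n. moment \<nu> n = M $ n)"
  proof (rule bounded_hamburger_moment)
    show "psd_upto n (fps_nth M)" for n
    proof (rule psd_free_levy[OF M])
      show "(fps_const s * R) $ (n + 2) = (s * R $ 2) * (\<integral>t. t ^ n \<partial>\<rho>)" for n
        using \<rho>(2)[of n] var by (simp add: moment_def R_def)
    qed (use s var cs_prob_integrable_power[OF \<rho>(1)] in \<open>auto simp: R_def\<close>)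
    show "M $ 0 = 1" using M by (simp add: R_fun_eq_def)
    show "\<bar>M $ n\<bar> \<le> 1 * K ^ n" for n
      using bounds[of n] mom[of n] by (simp add: moment_fps_def)
  qed (rule K(1))
  then obtain \<nu> where \<nu>: "cs_prob \<nu>" "\<And>n. moment \<nu> n = M $ n" by blast
  then have "moment_fps \<nu> = M" by (simp add: moment_fps_def fps_eq_iff)
  with M have "R_transform \<nu> = fps_const s * R" by (intro R_transform_eqI) simp
  with \<nu>(1) show ?thesis by (auto simp: R_def)
qed

theorem free_inf_divI:
  assumes \<mu>: "cs_prob \<mu>"
    and pos: "\<And>n. 0 \<le> R_transform \<mu> $ n" and var: "0 < R_transform \<mu> $ 2"
    and psd: "\<And>n. psd_upto n (\<lambda>k. R_transform \<mu> $ (k + 2))"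
  shows "free_inf_div \<mu>"
  unfolding free_inf_div_def
proof (intro allI impI)
  fix N :: nat assume N: "1 \<le> N"
  define c where "c k = real k / real N" for k
  have "\<forall>k. \<exists>\<nu>. k \<le> N \<longrightarrow> cs_prob \<nu> \<and> R_transform \<nu> = fps_const (c k) * R_transform \<mu>"
    using ex_cs_prob_scaled_R[OF assms] N by (auto simp: c_def divide_le_eq_1)
  then obtain \<nu> where \<nu>: "\<And>k. k \<le> N \<Longrightarrow> cs_prob (\<nu> k)"
    "\<And>k. k \<le> N \<Longrightarrow> R_transform (\<nu> k) = fps_const (c k) * R_transform \<mu>"
    by metis
  have "free_conv_power (\<nu> 1) k = \<nu> k" if "k \<le> N" for k
    using that
  proof (induction k)
    case 0
    have "return borel 0 = \<nu> 0"
      using \<nu>[of 0] by (intro cs_prob_R_transform_inj) (auto simp: cs_prob_return R_transform_return_0 c_def)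
    then show ?case by simp
  next
    case (Suc k)
    have "c (Suc k) = c k + c 1" by (simp add: c_def add_divide_distrib)
    then have "R_transform (\<nu> (Suc k)) = R_transform (\<nu> k) + R_transform (\<nu> 1)"
      using Suc N \<nu>(2)[of "Suc k"] \<nu>(2)[of k] \<nu>(2)[of 1]
      by (simp add: distrib_right flip: fps_const_add)
    then have "free_conv (\<nu> k) (\<nu> 1) = \<nu> (Suc k)"
      using Suc.prems by (intro free_conv_eqI \<nu>(1))
    then show ?case using Suc by simp
  qed
  moreover have "\<nu> N = \<mu>"
    using N \<mu> \<nu>[of N] by (intro cs_prob_R_transform_inj) (auto simp: c_def)
  ultimately show "\<exists>\<nu>. cs_prob \<nu> \<and> free_conv_power \<nu> N = \<mu>"
    using \<nu>(1)[of 1] N by auto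
qed

section \<open>The Marchenko-Pastur distribution\<close>

text \<open>\<open>marchenko_pastur\<close> and \<open>mu2\<close> are both given by a set function
  of this shape, so countable additivity and the integral formula are proved once for both.\<close>

lemma mix_measure:
  fixes \<nu> :: "real measure" and a b :: real
  assumes [measurable_cong]: "sets \<nu> = sets borel" and ab: "0 \<le> a" "0 \<le> b"
  defines "\<mu> \<equiv> measure_of UNIV (sets borel) (\<lambda>A. ennreal a * indicator A (0::real) + ennreal b * emeasure \<nu> A)"
  shows "sets \<mu> = sets borel"
    and "f \<in> borel_measurable borel \<Longrightarrow> (\<integral>\<^sup>+x. f x \<partial>\<mu>) = ennreal a * f 0 + ennreal b * (\<integral>\<^sup>+x. f x \<partial>\<nu>)"
proof -
  show sets: "sets \<mu> = sets borel"
    unfolding \<mu>_def by (metis sets.sigma_sets_eq sets_measure_of space_borel subset_UNIV UNIV_I Pow_UNIV)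
  have emeasure: "emeasure \<mu> A = ennreal a * indicator A 0 + ennreal b * emeasure \<nu> A" if "A \<in> sets borel" for A
    unfolding \<mu>_def
  proof (rule emeasure_measure_of_sigma[where \<Omega> = UNIV])
    show "sigma_algebra (UNIV::real set) (sets borel)" using sets.sigma_algebra_axioms[of "borel :: real measure"] by simp
    show "positive (sets borel) (\<lambda>A. ennreal a * indicator A (0::real) + ennreal b * emeasure \<nu> A)"
      by (simp add: positive_def)
    show "countably_additive (sets borel) (\<lambda>A. ennreal a * indicator A (0::real) + ennreal b * emeasure \<nu> A)"
    proof (rule countably_additiveI)
      fix A :: "nat \<Rightarrow> real set" assume A: "range A \<subseteq> sets borel" "disjoint_family A"
      then show "(\<Sum>i. ennreal a * indicator (A i) 0 + ennreal b * emeasure \<nu> (A i)) 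
        = ennreal a * indicator (\<Union> (range A)) 0 + ennreal b * emeasure \<nu> (\<Union> (range A))"
        using assms(1) by (subst suminf_add[symmetric])
          (auto simp: ennreal_suminf_cmult suminf_indicator suminf_emeasure)
    qed
  qed fact
  show "(\<integral>\<^sup>+x. f x \<partial>\<mu>) = ennreal a * f 0 + ennreal b * (\<integral>\<^sup>+x. f x \<partial>\<nu>)" if "f \<in> borel_measurable borel"
    using that
  proof (induction rule: borel_measurable_induct)
    case (cong f g)
    then show ?case by (metis UNIV_I nn_integral_cong space_borel sets_eq_imp_space_eq ext)
  next
    case (set A)
    then show ?case using sets assms(1) by (simp add: emeasure)
  next
    case (mult u c)
    have [measurable]: "u \<in> borel_measurable \<mu>" "u \<in> borel_measurable \<nu>"
      using mult sets assms(1) by (simp_all cong: measurable_cong_sets)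
    show ?case using mult by (simp add: nn_integral_cmult distrib_left mult_ac)
  next
    case (add u v)
    have [measurable]: "u \<in> borel_measurable \<mu>" "u \<in> borel_measurable \<nu>" "v \<in> borel_measurable \<mu>" "v \<in> borel_measurable \<nu>"
      using add sets assms(1) by (simp_all cong: measurable_cong_sets)
    show ?case using add by (simp add: nn_integral_add distrib_left add_ac)
  next
    case (seq U)
    have [measurable]: "U i \<in> borel_measurable \<mu>" "U i \<in> borel_measurable \<nu>" for i
      using seq sets assms(1) by (simp_all cong: measurable_cong_sets)
    have mono: "incseq (\<lambda>i. U i x)" for x using seq(3) by (auto simp: incseq_def le_fun_def)
    have mi: "incseq (\<lambda>i. \<integral>\<^sup>+x. U i x \<partial>\<nu>)"
      using seq(3) by (auto simp: incseq_def le_fun_def intro!: nn_integral_mono)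
    have "(\<integral>\<^sup>+x. (SUP i. U i x) \<partial>\<mu>) = (SUP i. ennreal a * U i 0 + ennreal b * (\<integral>\<^sup>+x. U i x \<partial>\<nu>))"
      using seq by (subst nn_integral_monotone_convergence_SUP) auto
    also have "\<dots> = (SUP i. ennreal a * U i 0) + (SUP i. ennreal b * (\<integral>\<^sup>+x. U i x \<partial>\<nu>))"
      using mono mi by (intro ennreal_SUP_add) (auto simp: incseq_def intro: mult_left_mono)
    also have "\<dots> = ennreal a * (SUP i. U i 0) + ennreal b * (\<integral>\<^sup>+x. (SUP i. U i x) \<partial>\<nu>)"
      using seq by (simp add: SUP_mult_left_ennreal nn_integral_monotone_convergence_SUP)
    finally show ?case by (simp add: SUP_apply image_comp)
  qed
qed

text \<open>\<open>F\<close> is an explicit antiderivative: for \<open>y = x - c\<close>,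
  \<open>p = q + c\<close>, \<open>Y = sqrt (r^2 - y^2)\<close>, the identity
  \<open>Y^2 = (p - y)(p + y) - s^2\<close> splits \<open>Y / (p + y)\<close> into
  \<open>(p - y) / Y - s^2 / ((p + y) Y)\<close>. At the ends \<open>Y\<close> vanishes and the
  arcsines jump by \<open>pi\<close>, giving \<open>pi (p - s)\<close>.\<close>

lemma semicircle_stieltjes:
  fixes c r q :: real
  assumes r: "r > 0" and q: "r \<le> q + c"
  defines "h \<equiv> \<lambda>x. sqrt (r\<^sup>2 - (x - c)\<^sup>2) / (q + x)"
  shows "set_integrable lborel {c - r<..<c + r} h"
    and "(LINT x:{c - r<..<c + r}|lborel. h x) = pi * (q + c - sqrt ((q + c)\<^sup>2 - r\<^sup>2))"
proof -
  define p where "p = q + c"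
  define s where "s = sqrt (p\<^sup>2 - r\<^sup>2)"
  have p: "p > 0" "r \<le> p" using r q by (auto simp: p_def)
  have s2: "s\<^sup>2 = p\<^sup>2 - r\<^sup>2" and s0: "s \<ge> 0"
    using p r by (auto simp: s_def power_mono)
  \<comment> \<open>For \<open>p > r\<close> this Moebius map carries \<open>-r\<close> and
    \<open>r\<close> to \<open>-1\<close> and \<open>1\<close>, and \<open>arcsin\<close> of it has
    derivative \<open>s / ((p + y) Y)\<close>.\<close>
  define g where "g y = (r\<^sup>2 + p * y) / (r * (p + y))" for y
  define F where "F x = sqrt (r\<^sup>2 - (x - c)\<^sup>2) + p * arcsin ((x - c) / r) - s * arcsin (g (x - c))" for x
  have g_bound: "-1 < g y \<and> g y < 1" and g_sq: "1 - (g y)\<^sup>2 = (s * sqrt (r\<^sup>2 - y\<^sup>2) / (r * (p + y)))\<^sup>2"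
    if "p > r" "-r < y" "y < r" for y
  proof -
    have py: "p + y > 0" using that p by linarith
    have "(p - r) * (r - y) > 0" "(p + r) * (r + y) > 0" using that p r by auto
    then show "-1 < g y \<and> g y < 1"
      using py r by (simp add: g_def field_simps power2_eq_square)
    have "y\<^sup>2 \<le> r\<^sup>2" using that r by (simp add: abs_le_square_iff[symmetric])
    then have "(s * sqrt (r\<^sup>2 - y\<^sup>2))\<^sup>2 = (p\<^sup>2 - r\<^sup>2) * (r\<^sup>2 - y\<^sup>2)"
      by (simp add: power_mult_distrib s2)
    also have "\<dots> = (r * (p + y))\<^sup>2 - (r\<^sup>2 + p * y)\<^sup>2"
      by (simp add: algebra_simps power2_eq_square)
    finally have "(s * sqrt (r\<^sup>2 - y\<^sup>2) / (r * (p + y)))\<^sup>2 = ((r * (p + y))\<^sup>2 - (r\<^sup>2 + p * y)\<^sup>2) / (r * (p + y))\<^sup>2"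
      by (simp only: power_divide)
    also have "\<dots> = 1 - (g y)\<^sup>2"
      using py r by (simp add: g_def power_divide diff_divide_distrib)
    finally show "1 - (g y)\<^sup>2 = (s * sqrt (r\<^sup>2 - y\<^sup>2) / (r * (p + y)))\<^sup>2" ..
  qed
  have deriv: "(F has_real_derivative h x) (at x)" if x: "c - r < x" "x < c + r" for x
  proof -
    define y where "y = x - c"
    have y: "-r < y" "y < r" using x by (auto simp: y_def)
    have py: "p + y > 0" using y p by linarith
    have "(r - y) * (r + y) > 0" using y by simp
    then have pos: "r\<^sup>2 - y\<^sup>2 > 0" by (simp add: algebra_simps power2_eq_square)
    define Y where "Y = sqrt (r\<^sup>2 - y\<^sup>2)"
    have Y: "Y > 0" "Y\<^sup>2 = r\<^sup>2 - y\<^sup>2" using pos by (auto simp: Y_def)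
    have d1: "((\<lambda>x. sqrt (r\<^sup>2 - (x - c)\<^sup>2)) has_real_derivative (- y / Y)) (at x)"
      using pos Y by (auto intro!: derivative_eq_intros simp: y_def[symmetric] Y_def field_simps)
    have d2: "((\<lambda>x. p * arcsin ((x - c) / r)) has_real_derivative (p / Y)) (at x)"
    proof -
      have "sqrt (1 - (y / r)\<^sup>2) = Y / r"
        using r by (intro real_sqrt_unique) (auto simp: power_divide Y field_simps intro: less_imp_le)
      then show ?thesis using y r Y
        by (auto intro!: derivative_eq_intros simp: y_def[symmetric] field_simps)
    qed
    have d3: "((\<lambda>x. s * arcsin (g (x - c))) has_real_derivative (s\<^sup>2 / ((p + y) * Y))) (at x)"
    \<comment> \<open>For \<open>s = 0\<close> the map \<open>g\<close> is constantly
      \<open>1\<close> inside the interval, where \<open>arcsin\<close> has no derivative; the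
      factor \<open>s\<close> then removes the term.\<close>
    proof (cases "s = 0")
      case False
      then have pr: "p > r" using p r by (cases "p = r") (auto simp: s_def)
      have s_pos: "s > 0" using False s0 by simp
      have dg: "((\<lambda>x. g (x - c)) has_real_derivative ((p\<^sup>2 - r\<^sup>2) / (r * (p + y)\<^sup>2))) (at x)"
      proof -
        have num: "p * (r * (p + y)) - (r\<^sup>2 + p * y) * r = r * (p\<^sup>2 - r\<^sup>2)"
          and den: "(r * (p + y)) * (r * (p + y)) = r * (r * (p + y)\<^sup>2)"
          by (simp_all add: algebra_simps power2_eq_square)
        have "((\<lambda>x. g (x - c)) has_real_derivative
            (p * (r * (p + y)) - (r\<^sup>2 + p * y) * r) / ((r * (p + y)) * (r * (p + y)))) (at x)"
          unfolding g_def using py r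
          by (auto intro!: derivative_eq_intros simp: y_def[symmetric])
        then show ?thesis unfolding num den using r by simp
      qed
      have "sqrt (1 - (g y)\<^sup>2) = s * Y / (r * (p + y))"
        using g_sq[OF pr y] py r s_pos Y by (intro real_sqrt_unique) (auto simp: Y_def)
      moreover have "s * (inverse (s * Y / (r * D)) * (s\<^sup>2 / (r * D\<^sup>2))) = s\<^sup>2 / (D * Y)" if "D > 0" for D
        using that r s_pos Y(1) by (simp add: field_simps power2_eq_square)
      ultimately have "s * (inverse (sqrt (1 - (g y)\<^sup>2)) * (s\<^sup>2 / (r * (p + y)\<^sup>2))) = s\<^sup>2 / ((p + y) * Y)"
        using py by simp
      moreover have "((\<lambda>x. s * arcsin (g (x - c))) has_real_derivative 
          (s * (inverse (sqrt (1 - (g y)\<^sup>2)) * (s\<^sup>2 / (r * (p + y)\<^sup>2))))) (at x)"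
        using DERIV_cmult[OF DERIV_chain2[OF DERIV_arcsin dg], of s] g_bound[OF pr y] 
        by (simp add: y_def[symmetric] s2)
      ultimately show ?thesis by simp
    qed simp
    have "- y / Y + p / Y - s\<^sup>2 / ((p + y) * Y) = h x"
    proof -
      have "h x = Y / (p + y)" by (simp add: h_def Y_def y_def p_def)
      also have "\<dots> = Y\<^sup>2 / ((p + y) * Y)" using Y(1) by (simp add: power2_eq_square)
      also have "\<dots> = - y / Y + p / Y - s\<^sup>2 / ((p + y) * Y)"
      proof -
        have "Y\<^sup>2 = (p - y) * (p + y) - s\<^sup>2"
          using Y(2) s2 by (simp add: algebra_simps power2_eq_square)
        then have "Y\<^sup>2 / ((p + y) * Y) = ((p - y) * (p + y)) / (Y * (p + y)) - s\<^sup>2 / ((p + y) * Y)"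
          by (simp add: diff_divide_distrib mult.commute)
        also have "((p - y) * (p + y)) / (Y * (p + y)) = p / Y - y / Y"
          using py by (simp add: diff_divide_distrib)
        finally show ?thesis by simp
      qed
      finally show ?thesis by simp
    qed
    then show ?thesis
      unfolding F_def using DERIV_diff[OF DERIV_add[OF d1 d2] d3] by simp
  qed
  have gr: "g r = 1"
  proof -
    have "r\<^sup>2 + p * r = r * (p + r)" by (simp add: algebra_simps power2_eq_square)
    then show ?thesis using p r by (simp add: g_def)
  qed
  have gmr: "g (- r) = - 1" if "s \<noteq> 0"
  proof -
    have "p > r" using that p r by (cases "p = r") (auto simp: s_def)
    moreover have "r\<^sup>2 + p * (- r) = - (r * (p + - r))" by (simp add: algebra_simps power2_eq_square)
    ultimately show ?thesis using r unfolding g_def by simp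
  qed
  have contF: "continuous_on {c - r..c + r} F"
  proof (cases "s = 0")
    case True
    show ?thesis unfolding F_def True using r
      by (auto intro!: continuous_intros simp: field_simps)
  next
    case False
    then have pr: "p > r" using p r by (cases "p = r") (auto simp: s_def)
    have "-1 \<le> g (x - c) \<and> g (x - c) \<le> 1" if "x \<in> {c - r..c + r}" for x
    proof -
      have "x - c = r \<or> x - c = -r \<or> (-r < x - c \<and> x - c < r)" using that by auto
      then show ?thesis using gr gmr[OF False] g_bound[OF pr, of "x - c"] by auto
    qed
    moreover have "continuous_on {c - r..c + r} (\<lambda>x. g (x - c))"
      unfolding g_def using pr r by (intro continuous_intros) auto
    ultimately show ?thesis unfolding F_def using r
      by (auto intro!: continuous_intros simp: field_simps)
  qed
  have conth: "isCont h x" if "c - r < x" "x < c + r" for x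
    unfolding h_def using that q by (intro continuous_intros) auto
  have hnn: "0 \<le> h x" if "c - r < x" "x < c + r" for x
  proof -
    have "\<bar>x - c\<bar> \<le> \<bar>r\<bar>" using that by auto
    then have "(x - c)\<^sup>2 \<le> r\<^sup>2" by (simp only: abs_le_square_iff)
    then show ?thesis using that q by (simp add: h_def)
  qed
  have limA: "((F \<circ> real_of_ereal) \<longlongrightarrow> F (c - r)) (at_right (ereal (c - r)))"
    using continuous_on_Icc_at_rightD[OF contF] r by (simp add: ereal_tendsto_simps1)
  have limB: "((F \<circ> real_of_ereal) \<longlongrightarrow> F (c + r)) (at_left (ereal (c + r)))"
    using continuous_on_Icc_at_leftD[OF contF] r by (simp add: ereal_tendsto_simps1)
  \<comment> \<open>For \<open>p = r\<close> the integrand is unbounded at the left end. This form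
    of the fundamental theorem works on the open interval and asks only for one-sided limits of
    \<open>F\<close>.\<close>
  note FTC = interval_integral_FTC_nonneg[of "ereal (c - r)" "ereal (c + r)" F h, OF _ _ _ _ limA limB]
  have int: "set_integrable lborel (einterval (ereal (c - r)) (ereal (c + r))) h"
    by (rule FTC(1)) (use r deriv conth hnn in auto)
  have val: "(LBINT x=ereal (c - r)..ereal (c + r). h x) = F (c + r) - F (c - r)"
    by (rule FTC(2)) (use r deriv conth hnn in auto)
  have einterval: "einterval (ereal (c - r)) (ereal (c + r)) = {c - r<..<c + r}"
    by (auto simp: einterval_def)
  show "set_integrable lborel {c - r<..<c + r} h" using int by (simp add: einterval)
  have "(LINT x:{c - r<..<c + r}|lborel. h x) = F (c + r) - F (c - r)"
    using val r by (simp add: interval_lebesgue_integral_def einterval)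
  also have "\<dots> = pi * (p - s)"
    using r gr gmr by (cases "s = 0") (simp_all add: F_def algebra_simps)
  finally show "(LINT x:{c - r<..<c + r}|lborel. h x) = pi * (q + c - sqrt ((q + c)\<^sup>2 - r\<^sup>2))"
    by (simp add: p_def s_def)
qed

text \<open>The integral formula passes through nonnegative integrals, hence the sign condition on
  \<open>[0, K]\<close>; powers and \<open>1 / (1 + w x)\<close> with \<open>w > 0\<close> meet
  it.\<close>

lemma mix_cs_prob:
  fixes \<nu> :: "real measure" and a b :: real
  assumes \<nu>: "sets \<nu> = sets borel" and ab: "0 \<le> a" "0 \<le> b"
    and mass: "ennreal a + ennreal b * emeasure \<nu> UNIV = 1"
    and K: "0 \<le> K" "AE x in \<nu>. 0 \<le> x \<and> x \<le> K"
  defines "\<mu> \<equiv> measure_of UNIV (sets borel) (\<lambda>A. ennreal a * indicator A (0::real) + ennreal b * emeasure \<nu> A)"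
  shows "cs_prob \<mu>" and "AE x in \<mu>. 0 \<le> x \<and> x \<le> K"
    and "\<And>f. f \<in> borel_measurable borel \<Longrightarrow> (\<And>x. 0 \<le> x \<Longrightarrow> x \<le> K \<Longrightarrow> 0 \<le> f x) \<Longrightarrow> integrable \<nu> f \<Longrightarrow>
        (\<integral>x. f x \<partial>\<mu>) = a * f 0 + b * (\<integral>x. f x \<partial>\<nu>)"
proof -
  note mix = mix_measure[OF \<nu> ab, folded \<mu>_def]
  note [measurable_cong] = \<nu> mix(1)
  have space: "space \<nu> = UNIV" "space \<mu> = UNIV"
    using \<nu> mix(1) by (metis sets_eq_imp_space_eq space_borel)+
  have "emeasure \<mu> UNIV = 1"
    using mix(2)[of "\<lambda>_. 1"] mass by (simp add: space)
  then have rd: "real_distribution \<mu>"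
    using mix(1) by (auto simp: real_distribution_def real_distribution_axioms_def space intro!: prob_spaceI)
  let ?N = "{x. \<not> (0 \<le> x \<and> x \<le> K)}"
  have "(\<integral>\<^sup>+x. indicator ?N x \<partial>\<nu>) = 0"
    using K(2) by (subst nn_integral_0_iff_AE) (auto simp: indicator_def)
  then have "(\<integral>\<^sup>+x. indicator ?N x \<partial>\<mu>) = 0"
    using mix(2)[of "indicator ?N"] K(1) by simp
  then show AE: "AE x in \<mu>. 0 \<le> x \<and> x \<le> K"
    by (subst (asm) nn_integral_0_iff_AE) (auto simp: indicator_def split: if_splits)
  then have "AE x in \<mu>. \<bar>x\<bar> \<le> K" by eventually_elim simp
  with rd show "cs_prob \<mu>" by (rule cs_probI)
  fix f :: "real \<Rightarrow> real"
  assume f [measurable]: "f \<in> borel_measurable borel" and nn: "\<And>x. 0 \<le> x \<Longrightarrow> x \<le> K \<Longrightarrow> 0 \<le> f x"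
    and int: "integrable \<nu> f"
  have 1: "AE x in \<nu>. 0 \<le> f x" using K(2) by eventually_elim (simp add: nn)
  have 2: "AE x in \<mu>. 0 \<le> f x" using AE by eventually_elim (simp add: nn)
  have "(\<integral>\<^sup>+x. ennreal (f x) \<partial>\<mu>) = ennreal a * ennreal (f 0) + ennreal b * ennreal (\<integral>x. f x \<partial>\<nu>)"
    using mix(2)[of "\<lambda>x. ennreal (f x)"] nn_integral_eq_integral[OF int 1] by simp
  also have "\<dots> = ennreal (a * f 0 + b * (\<integral>x. f x \<partial>\<nu>))"
    using ab nn[of 0] K(1) integral_nonneg_AE[OF 1] by (simp add: ennreal_mult ennreal_plus)
  finally show "(\<integral>x. f x \<partial>\<mu>) = a * f 0 + b * (\<integral>x. f x \<partial>\<nu>)"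
    using 2 ab nn[of 0] K(1) integral_nonneg_AE[OF 1] by (simp add: integral_eq_nn_integral del: ennreal_plus)
qed

section \<open>Mass, support and transform of the Marchenko-Pastur law\<close>

lemma mp_density_eq:
  assumes "t > 0"
  shows "mp_density t x = indicator {(1 + t) - 2 * sqrt t<..<(1 + t) + 2 * sqrt t} x *
     (sqrt ((2 * sqrt t)\<^sup>2 - (x - (1 + t))\<^sup>2) / (0 + x)) / (2 * pi)"
proof -
  have "(1 - sqrt t)\<^sup>2 = (1 + t) - 2 * sqrt t" "(1 + sqrt t)\<^sup>2 = (1 + t) + 2 * sqrt t"
    "(2 * sqrt t)\<^sup>2 = 4 * t"
    using assms by (simp_all add: power2_eq_square algebra_simps)
  then show ?thesis by (simp add: mp_density_def indicator_def mult_ac diff_diff_eq)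
qed

lemma mp_edge: "t > 0 \<Longrightarrow> 2 * sqrt t \<le> 1 + t"
  using zero_le_power2[of "1 - sqrt t"] by (simp add: power2_eq_square algebra_simps)

lemma mp_density_nonneg: "t > 0 \<Longrightarrow> 0 \<le> mp_density t x"
proof -
  assume t: "t > 0"
  consider "x \<in> {(1 + t) - 2 * sqrt t<..<(1 + t) + 2 * sqrt t}" | "mp_density t x = 0"
    by (auto simp: mp_density_eq[OF t] indicator_def)
  then show ?thesis
  proof cases
    case 1
    then have "\<bar>x - (1 + t)\<bar> \<le> \<bar>2 * sqrt t\<bar>" by auto
    then have "(x - (1 + t))\<^sup>2 \<le> (2 * sqrt t)\<^sup>2" by (simp only: abs_le_square_iff)
    moreover have "x \<ge> 0" using 1 mp_edge[OF t] by simp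
    ultimately show ?thesis by (simp add: mp_density_eq[OF t])
  qed simp
qed

lemma mp_density_measurable [measurable]: "mp_density t \<in> borel_measurable borel"
  unfolding mp_density_def by measurable

text \<open>The integrand is split into partial fractions \<open>1 / (x (1 + wx)) = 1 / x - 1 / (1/w + x)\<close>.\<close>

lemma mp_density_integrals:
  assumes t: "t > 0" 
  shows "integrable lborel (mp_density t)" "(\<integral>x. mp_density t x \<partial>lborel) = (1 + t - \<bar>1 - t\<bar>) / 2"
    and "w > 0 \<Longrightarrow> integrable lborel (\<lambda>x. mp_density t x * (1 / (1 + w * x)))"
    and "w > 0 \<Longrightarrow> (\<integral>x. mp_density t x * (1 / (1 + w * x)) \<partial>lborel)
      = (sqrt ((1 / w + (1 + t))\<^sup>2 - 4 * t) - \<bar>1 - t\<bar> - 1 / w) / 2"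
proof -
  define r c where "r = 2 * sqrt t" and "c = 1 + t"
  have r: "r > 0" "r \<le> c" "r\<^sup>2 = 4 * t" using t mp_edge[OF t] by (auto simp: r_def c_def power_mult_distrib)
  define h where "h q x = sqrt (r\<^sup>2 - (x - c)\<^sup>2) / (q + x)" for q x :: real
  have h: "integrable lborel (\<lambda>x. indicator {c - r<..<c + r} x * h q x)"
    "(\<integral>x. indicator {c - r<..<c + r} x * h q x \<partial>lborel) = pi * (q + c - sqrt ((q + c)\<^sup>2 - r\<^sup>2))"
    if "q \<ge> 0" for q
    using semicircle_stieltjes[of r q c] r that
    by (simp_all add: h_def set_integrable_def set_lebesgue_integral_def)
  have dens: "mp_density t = (\<lambda>x. (1 / (2 * pi)) * (indicator {c - r<..<c + r} x * h 0 x))"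
    unfolding mp_density_eq[OF t] h_def r_def c_def by (simp add: fun_eq_iff)
  have "(1 + t)\<^sup>2 - 4 * t = (1 - t)\<^sup>2" by (simp add: power2_eq_square algebra_simps)
  then have root: "sqrt (c\<^sup>2 - r\<^sup>2) = \<bar>1 - t\<bar>" by (simp add: c_def r)
  show "integrable lborel (mp_density t)"
    unfolding dens using h(1)[of 0] by (intro integrable_mult_right) simp
  show "(\<integral>x. mp_density t x \<partial>lborel) = (1 + t - \<bar>1 - t\<bar>) / 2"
    unfolding dens using h(2)[of 0] root by (simp add: c_def)
  assume w: "w > 0"
  have eq: "mp_density t x * (1 / (1 + w * x)) = 
     (1 / (2 * pi)) * (indicator {c - r<..<c + r} x * h 0 x - indicator {c - r<..<c + r} x * h (1 / w) x)" for x
  proof (cases "x \<in> {c - r<..<c + r}")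
    case True
    then have x: "x > 0" using r by simp
    have nz: "1 + w * x > 0" "1 / w + x > 0" using w x by (auto intro: add_pos_pos)
    have "1 / x - 1 / (1 / w + x) = 1 / x * (1 / (1 + w * x))"
      using w x nz by (simp add: field_simps)
    then have "h 0 x - h (1 / w) x = sqrt (r\<^sup>2 - (x - c)\<^sup>2) * (1 / x * (1 / (1 + w * x)))"
      by (simp add: h_def diff_divide_distrib divide_inverse flip: right_diff_distrib)
    with True show ?thesis by (simp add: dens h_def)
  qed (simp add: dens)
  have q: "1 / w \<ge> 0" using w by simp
  show "integrable lborel (\<lambda>x. mp_density t x * (1 / (1 + w * x)))"
    unfolding eq by (intro integrable_mult_right Bochner_Integration.integrable_diff h q) simp
  have "(\<integral>x. mp_density t x * (1 / (1 + w * x)) \<partial>lborel) 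
     = (1 / (2 * pi)) * (pi * (0 + c - sqrt ((0 + c)\<^sup>2 - r\<^sup>2)) - pi * (1 / w + c - sqrt ((1 / w + c)\<^sup>2 - r\<^sup>2)))"
    unfolding eq using h[of 0] h[OF q] by simp
  also have "\<dots> = (sqrt ((1 / w + (1 + t))\<^sup>2 - 4 * t) - \<bar>1 - t\<bar> - 1 / w) / 2"
    unfolding add_0 root unfolding r c_def by (simp add: field_simps)
  finally show "(\<integral>x. mp_density t x * (1 / (1 + w * x)) \<partial>lborel)
      = (sqrt ((1 / w + (1 + t))\<^sup>2 - 4 * t) - \<bar>1 - t\<bar> - 1 / w) / 2" .
qed

text \<open>The density has mass \<open>min 1 t\<close>, which the atom completes to
  \<open>1\<close>. In the transform the atom and \<open>- |1 - t| / 2\<close> combine to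
  \<open>(1 - t) / 2\<close>, so one formula covers all \<open>t\<close>. With \<open>w > 0\<close>
  the pole stays off the support.\<close>

lemma marchenko_pastur_facts:
  assumes t: "t > 0"
  shows "cs_prob (marchenko_pastur t)" and "AE x in marchenko_pastur t. 0 \<le> x \<and> x \<le> (1 + t) + 2 * sqrt t"
    and "w > 0 \<Longrightarrow> (\<integral>x. 1 / (1 + w * x) \<partial>marchenko_pastur t)
      = ((1 - t) + sqrt ((1 / w + (1 + t))\<^sup>2 - 4 * t) - 1 / w) / 2"
proof -
  define \<nu> where "\<nu> = density lborel (mp_density t)"
  have sets\<nu>: "sets \<nu> = sets borel" by (simp add: \<nu>_def)
  have eq: "marchenko_pastur t = measure_of UNIV (sets borel)
     (\<lambda>A. ennreal (max (1 - t) 0) * indicator A 0 + ennreal 1 * emeasure \<nu> A)"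
    unfolding marchenko_pastur_def
  proof (rule measure_of_eq)
    fix A :: "real set" assume "A \<in> sigma_sets UNIV (sets borel)"
    then have "A \<in> sets borel" by (metis sets.sigma_sets_eq space_borel)
    then have "emeasure \<nu> A = (\<integral>\<^sup>+ x. indicator A x * ennreal (mp_density t x) \<partial>lborel)"
      unfolding \<nu>_def by (subst emeasure_density) (auto simp: mult.commute)
    then show "ennreal (max (1 - t) 0) * indicator A 0 + (\<integral>\<^sup>+ x. indicator A x * ennreal (mp_density t x) \<partial>lborel)
      = ennreal (max (1 - t) 0) * indicator A 0 + ennreal 1 * emeasure \<nu> A" by simp
  qed simp
  have nn: "AE x in lborel. 0 \<le> mp_density t x" using mp_density_nonneg[OF t] by simp
  have "emeasure \<nu> UNIV = (\<integral>\<^sup>+x. ennreal (mp_density t x) \<partial>lborel)"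
    unfolding \<nu>_def by (subst emeasure_density) auto
  also have "\<dots> = ennreal ((1 + t - \<bar>1 - t\<bar>) / 2)"
    using nn_integral_eq_integral[OF mp_density_integrals(1)[OF t] nn] mp_density_integrals(2)[OF t] by simp
  finally have mass: "ennreal (max (1 - t) 0) + ennreal 1 * emeasure \<nu> UNIV = 1"
    using t by (simp add: max_def abs_if flip: ennreal_plus)
  have supp: "AE x in \<nu>. 0 \<le> x \<and> x \<le> (1 + t) + 2 * sqrt t"
    unfolding \<nu>_def using mp_edge[OF t]
    by (subst AE_density) (auto simp: mp_density_eq[OF t] indicator_def intro!: AE_I2)
  have K: "0 \<le> (1 + t) + 2 * sqrt t" using t by simp
  note mix = mix_cs_prob[OF sets\<nu> _ _ mass K supp, folded eq]
  show "cs_prob (marchenko_pastur t)" "AE x in marchenko_pastur t. 0 \<le> x \<and> x \<le> (1 + t) + 2 * sqrt t"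
    using mix(1,2) by auto
  assume w: "w > 0"
  have "(\<integral>x. 1 / (1 + w * x) \<partial>marchenko_pastur t) = max (1 - t) 0 * (1 / (1 + w * 0)) + 1 * (\<integral>x. 1 / (1 + w * x) \<partial>\<nu>)"
    using w mp_density_integrals(3)[OF t w] unfolding \<nu>_def
    by (intro mix(3)[unfolded \<nu>_def]) (auto simp: integrable_density[OF _ _ nn])
  also have "(\<integral>x. 1 / (1 + w * x) \<partial>\<nu>) = (sqrt ((1 / w + (1 + t))\<^sup>2 - 4 * t) - \<bar>1 - t\<bar> - 1 / w) / 2"
    unfolding \<nu>_def using mp_density_integrals(4)[OF t w] by (subst integral_density[OF _ _ nn]) auto
  finally show "(\<integral>x. 1 / (1 + w * x) \<partial>marchenko_pastur t)
      = ((1 - t) + sqrt ((1 / w + (1 + t))\<^sup>2 - 4 * t) - 1 / w) / 2"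
    by (simp add: max_def abs_if field_simps split: if_splits)
qed

section \<open>The R-transforms of the three measures\<close>

text \<open>The transform is known for negative arguments only, so a one-sided identity principle is
  needed. Once the leading power is removed, a nonzero constant term would contradict continuity at
  \<open>0\<close>.\<close>

lemma has_fps_expansion_eq_0:
  fixes f :: "real \<Rightarrow> real" and F :: "real fps"
  assumes F: "f has_fps_expansion F" and 0: "eventually (\<lambda>z. f z = 0) (at_left 0)"
  shows "F = 0"
proof (rule ccontr)
  assume "F \<noteq> 0"
  define n where "n = subdegree F"
  define G where "G = fps_shift n F"
  have rad: "0 < fps_conv_radius F" and ev: "\<forall>\<^sub>F z in nhds 0. eval_fps F z = f z"
    using F by (auto simp: has_fps_expansion_def)
  have ball: "\<forall>\<^sub>F z in nhds (0::real). z \<in> eball 0 (fps_conv_radius F)"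
    using rad by (intro eventually_nhds_in_open) (auto simp: zero_ereal_def)
  have le: "at_left (0::real) \<le> nhds 0" by (simp add: at_within_def)
  note filter_leD[OF le ball] filter_leD[OF le ev]
  moreover have "\<forall>\<^sub>F z in at_left (0::real). z \<noteq> 0" by (simp add: eventually_at_filter)
  ultimately have "\<forall>\<^sub>F z in at_left 0. eval_fps G z = 0"
    using 0 by eventually_elim (simp add: G_def n_def eval_fps_shift)
  then have "(eval_fps G \<longlongrightarrow> 0) (at_left 0)" by (simp add: tendsto_eventually)
  moreover have "isCont (eval_fps G) 0"
    using rad by (intro continuous_eval_fps) (auto simp: G_def zero_ereal_def)
  then have "(eval_fps G \<longlongrightarrow> eval_fps G 0) (at_left 0)"
    by (auto simp: isCont_def intro: tendsto_within_subset)
  ultimately have "eval_fps G 0 = 0" using tendsto_unique by (metis trivial_limit_at_left_real)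
  then show False using \<open>F \<noteq> 0\<close> by (simp add: eval_fps_at_0 G_def n_def)
qed

text \<open>This is \<open>M - 1 = t W / (1 - W)\<close> with \<open>W = XM\<close>, the expected
  R-transform with its denominator cleared.\<close>

lemma marchenko_pastur_fps:
  assumes t: "t > 0"
  defines "M \<equiv> moment_fps (marchenko_pastur t)"
  shows "(M - 1) * (1 - fps_X * M) = fps_const t * (fps_X * M)"
proof -
  let ?\<mu> = "marchenko_pastur t"
  define K where "K = (1 + t) + 2 * sqrt t"
  have K: "K > 0" using t by (simp add: K_def add_pos_nonneg)
  have bd: "AE x in ?\<mu>. \<bar>x\<bar> \<le> K"
    using marchenko_pastur_facts(2)[OF t] unfolding K_def by eventually_elim simp
  note sums = cs_prob_moment_sums[OF marchenko_pastur_facts(1)[OF t] bd]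
  have "\<bar>1 / (2 * K)\<bar> * K < 1" using K by simp
  from sums[OF this] have "summable (\<lambda>n. fps_nth M n * (1 / (2 * K)) ^ n)"
    by (simp add: M_def moment_fps_def sums_iff)
  then have "fps_conv_radius M \<ge> norm (1 / (2 * K))"
    unfolding fps_conv_radius_def by (rule conv_radius_geI)
  moreover have "ereal (norm (1 / (2 * K))) > 0" using K by simp
  ultimately have "fps_conv_radius M > 0" by (rule order_less_le_trans[rotated])
  then have M: "eval_fps M has_fps_expansion M" by (rule eval_fps_has_fps_expansion)
  have "(\<lambda>z. (eval_fps M z - 1) * (1 - z * eval_fps M z) - t * (z * eval_fps M z)) 
      has_fps_expansion ((M - 1) * (1 - fps_X * M) - fps_const t * (fps_X * M))"
    by (intro fps_expansion_intros M)
  moreover have "\<forall>\<^sub>F z in at_left 0. (eval_fps M z - 1) * (1 - z * eval_fps M z) - t * (z * eval_fps M z) = 0"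
  proof -
    have "- (1 / K) < 0" using K by simp
    then have "\<forall>\<^sub>F z in at_left 0. z \<in> {- (1 / K)<..<0}" by (rule eventually_at_left_real)
    then show ?thesis
    proof eventually_elim
      case (elim z)
      \<comment> \<open>In these variables the squared transform formula reads
        \<open>m^2 + m (v - 1 + t) - v = 0\<close>; multiplying by \<open>w\<close> gives the
        claim.\<close>
      define w v where "w = - z" and "v = 1 / w"
      have w: "w > 0" "w * v = 1" "w * K < 1" using elim K by (auto simp: w_def v_def field_simps)
      define m where "m = eval_fps M z"
      have "(\<lambda>n. fps_nth M n * z ^ n) sums (\<integral>x. 1 / (1 - z * x) \<partial>?\<mu>)"
        using sums[of z] w by (simp add: M_def moment_fps_def w_def)
      then have "m = (\<integral>x. 1 / (1 - z * x) \<partial>?\<mu>)" by (simp add: m_def eval_fps_def sums_iff)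
      also have "\<dots> = ((1 - t) + sqrt ((v + (1 + t))\<^sup>2 - 4 * t) - v) / 2"
        using marchenko_pastur_facts(3)[OF t w(1)] by (simp add: w_def v_def)
      finally have root: "2 * m - (1 - t) + v = sqrt ((v + (1 + t))\<^sup>2 - 4 * t)" by simp
      have "(v + (1 + t))\<^sup>2 - 4 * t = v\<^sup>2 + 2 * v * (1 + t) + (1 - t)\<^sup>2"
        by (simp add: power2_eq_square algebra_simps)
      also have "\<dots> \<ge> 0" using w t by (simp add: v_def)
      finally have "(2 * m - (1 - t) + v)\<^sup>2 = (v + (1 + t))\<^sup>2 - 4 * t"
        unfolding root by simp
      then have "m * m + m * (v - 1 + t) - v = 0" by (simp add: power2_eq_square algebra_simps)
      then have "w * (m * m + m * (v - 1 + t) - v) = 0" by simp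
      then have "w * (m * m) + m * (w * v) - w * m + w * t * m - w * v = 0" by (simp add: algebra_simps)
      then show ?case unfolding w(2) m_def[symmetric] by (simp add: w_def algebra_simps)
    qed
  qed
  ultimately have "(M - 1) * (1 - fps_X * M) - fps_const t * (fps_X * M) = 0"
    by (rule has_fps_expansion_eq_0)
  then show ?thesis by simp
qed

text \<open>In an integral domain the two roots differ by a sign, which the constant term
  fixes.\<close>

lemma fps_inverse_sqrt_unique:
  fixes p q d :: "real fps"
  assumes "p * p * d = 1" "q * q * d = 1" "p $ 0 = 1" "q $ 0 = 1"
  shows "p = q"
proof -
  have "d \<noteq> 0" using assms(1) by auto
  moreover have "(p * p) * d = (q * q) * d" using assms by simp
  ultimately have "p * p = q * q" by simp
  then have "(p - q) * (p + q) = 0" by (simp add: algebra_simps)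
  moreover have "(p + q) $ 0 \<noteq> 0" using assms by simp
  then have "p + q \<noteq> 0" by (metis fps_zero_nth)
  ultimately show ?thesis by simp
qed

section \<open>The measure \<open>mu1\<close>\<close>

definition R_mu1 :: "real fps" where "R_mu1 = fps_X * inverse (1 - fps_const 2 * fps_X)"

lemma R_mu1_compose:
  assumes "W $ 0 = 0" shows "R_mu1 oo W = W * inverse (1 - fps_const 2 * W)"
  using assms by (simp add: R_mu1_def fps_compose_mult_distrib fps_inverse_compose fps_compose_sub_distrib)

lemma R_mu1_nth: "R_mu1 $ n = (if n = 0 then 0 else 2 ^ (n - 1))"
  by (simp add: R_mu1_def fps_inverse_geometric)

text \<open>Dilation by \<open>2\<close> substitutes \<open>2X\<close> in the moment series, turning
  the quadratic relation at \<open>t = 1/2\<close> into \<open>(M - 1)(1 - 2XM) = XM\<close>, the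
  functional equation for \<open>z / (1 - 2z)\<close>.\<close>

lemma mu1_facts: "cs_prob mu1" "R_transform mu1 = R_mu1"
proof -
  let ?\<nu> = "marchenko_pastur (1/2)"
  have \<nu>: "cs_prob ?\<nu>" by (rule marchenko_pastur_facts) simp
  interpret real_distribution ?\<nu> by (rule cs_prob_real_distribution[OF \<nu>])
  obtain K where K: "K > 0" "AE x in ?\<nu>. \<bar>x\<bar> \<le> K" using cs_prob_bounded[OF \<nu>] .
  show cs: "cs_prob mu1"
  proof (rule cs_probI)
    show "real_distribution mu1" unfolding mu1_def dilation_def by (intro real_distribution_distr) simp
    have "AE x in ?\<nu>. \<bar>2 * x\<bar> \<le> 2 * K" using K(2) by eventually_elim simp
    then show "AE x in mu1. \<bar>x\<bar> \<le> 2 * K"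
      unfolding mu1_def dilation_def by (subst AE_distr_iff) auto
  qed
  define N M where "N = moment_fps ?\<nu>" and "M = moment_fps mu1"
  have "moment mu1 n = 2 ^ n * moment ?\<nu> n" for n
    unfolding moment_def mu1_def dilation_def by (subst integral_distr) (auto simp: power_mult_distrib)
  then have M: "M = N oo (fps_const 2 * fps_X)"
    by (simp add: M_def N_def moment_fps_def fps_compose_linear fps_eq_iff)
  have "((N - 1) * (1 - fps_X * N)) oo (fps_const 2 * fps_X) = (fps_const (1/2) * (fps_X * N)) oo (fps_const 2 * fps_X)"
    unfolding N_def by (subst marchenko_pastur_fps) simp_all
  then have "(M - 1) * (1 - fps_const 2 * (fps_X * M)) = fps_const (1/2) * fps_const 2 * (fps_X * M)"
    by (simp add: M fps_compose_mult_distrib fps_compose_sub_distrib mult_ac)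
  then have eq: "(M - 1) * (1 - fps_const 2 * (fps_X * M)) = fps_X * M" by simp
  have "R_fun_eq R_mu1 M" unfolding R_fun_eq_def
  proof
    show "M $ 0 = 1" using cs_prob_moment_0[OF cs] by (simp add: M_def moment_fps_def)
    define W D where "W = fps_X * M" and "D = 1 - fps_const 2 * W"
    have "R_mu1 oo W = W * inverse D" by (simp add: R_mu1_compose W_def D_def)
    also have "\<dots> = ((M - 1) * D) * inverse D" using eq by (simp add: W_def D_def)
    also have "\<dots> = (M - 1) * (D * inverse D)" by (simp only: mult.assoc)
    also have "D * inverse D = 1" by (rule inverse_mult_eq_1') (simp add: D_def W_def)
    finally show "(R_mu1 oo fps_X * M) + 1 = M" by (simp add: W_def)
  qed
  then show "R_transform mu1 = R_mu1" unfolding M_def by (rule R_transform_eqI)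
qed

section \<open>The measure \<open>mu2\<close>\<close>

text \<open>The Catalan series \<open>c\<close> in \<open>X/2\<close> satisfies \<open>(1 - Xc)\<^sup>2 = 1 - 2X\<close>, so that
  \<open>(1 - 2X)\<^bsup>-1/2\<^esup> = 1 / (1 - X - X\<^sup>2S)\<close> where \<open>S\<close> is the shift of \<open>c\<close>; this form
  makes its coefficients positive semidefinite.\<close>

definition half_catalan :: "real fps" where "half_catalan = Abs_fps (\<lambda>n. moment (marchenko_pastur 1) n / 2 ^ n)"

definition inv_sqrt :: "real fps" where "inv_sqrt = inverse (1 - fps_X * half_catalan)"

definition R_mu2 :: "real fps" where "R_mu2 = fps_const (1/2) * (inv_sqrt - 1)"

lemma catalan_fps:
  defines "C \<equiv> moment_fps (marchenko_pastur 1)"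
  shows "C - 1 = fps_X * C\<^sup>2" and "C $ 0 = 1"
proof -
  show "C $ 0 = 1"
    using cs_prob_moment_0[OF marchenko_pastur_facts(1)] by (simp add: C_def moment_fps_def)
  have "(C - 1) * (1 - fps_X * C) = fps_X * C"
    using marchenko_pastur_fps[of 1] by (simp add: C_def)
  then show "C - 1 = fps_X * C\<^sup>2" by (simp add: algebra_simps power2_eq_square)
qed

lemma half_catalan_eq: "2 * (half_catalan - 1) = fps_X * half_catalan\<^sup>2"
proof -
  let ?C = "moment_fps (marchenko_pastur 1)" and ?h = "fps_const (1/2) * fps_X :: real fps"
  have half_catalan: "half_catalan = ?C oo ?h"
    by (simp add: half_catalan_def moment_fps_def fps_compose_linear power_divide)
  have "(?C - 1) oo ?h = (fps_X * ?C\<^sup>2) oo ?h" by (simp only: catalan_fps(1))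
  then have "half_catalan - 1 = fps_const (1/2) * (fps_X * half_catalan\<^sup>2)"
    by (simp add: half_catalan fps_compose_mult_distrib fps_compose_sub_distrib fps_compose_power[symmetric] mult.assoc)
  then have "2 * (half_catalan - 1) = 2 * fps_const (1/2) * (fps_X * half_catalan\<^sup>2)" by (simp only: mult.assoc)
  then show ?thesis by (simp add: numeral_fps_const)
qed

lemma inv_sqrt_mult: "inv_sqrt * (1 - fps_X * half_catalan) = 1"
  unfolding inv_sqrt_def by (rule inverse_mult_eq_1) simp

lemma inv_sqrt_square: "inv_sqrt * inv_sqrt * (1 - 2 * fps_X) = 1"
proof -
  have "fps_X * (fps_X * half_catalan\<^sup>2) = fps_X * (2 * (half_catalan - 1))" by (simp only: half_catalan_eq)
  then have "(1 - fps_X * half_catalan) * (1 - fps_X * half_catalan) = 1 - 2 * fps_X"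
    by (simp add: algebra_simps power2_eq_square)
  then have "inv_sqrt * inv_sqrt * (1 - 2 * fps_X) = (inv_sqrt * (1 - fps_X * half_catalan)) * (inv_sqrt * (1 - fps_X * half_catalan))"
    by (simp add: mult_ac)
  then show ?thesis by (simp add: inv_sqrt_mult)
qed

lemma inv_sqrt_nth_0: "inv_sqrt $ 0 = 1"
  by (simp add: inv_sqrt_def)

text \<open>A composition with \<open>inv_sqrt\<close> is recognised from its square and its
  constant term, so no binomial series has to be expanded.\<close>

lemma inv_sqrt_compose:
  assumes "W $ 0 = 0" "C * C * (1 - 2 * W) = 1" "C $ 0 = 1"
  shows "inv_sqrt oo W = C"
proof (rule fps_inverse_sqrt_unique)
  have "(inv_sqrt * inv_sqrt * (1 - 2 * fps_X)) oo W = 1" by (simp add: inv_sqrt_square)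
  moreover have "(2 :: real fps) oo W = 2" by (simp add: numeral_fps_const)
  ultimately show "(inv_sqrt oo W) * (inv_sqrt oo W) * (1 - 2 * W) = 1"
    using assms(1) by (simp add: fps_compose_mult_distrib fps_compose_sub_distrib)
qed (use assms in \<open>auto simp: inv_sqrt_nth_0\<close>)

lemma R_mu2_compose: "W $ 0 = 0 \<Longrightarrow> R_mu2 oo W = fps_const (1/2) * ((inv_sqrt oo W) - 1)"
  by (simp add: R_mu2_def fps_compose_mult_distrib fps_compose_sub_distrib)

lemma mp_1_AE_nonneg: "AE x in marchenko_pastur 1. 0 \<le> x"
  using marchenko_pastur_facts(2)[of 1] by (auto elim: eventually_mono)

lemma half_catalan_nth_nonneg: "0 \<le> half_catalan $ n"
proof -
  have "0 \<le> moment (marchenko_pastur 1) n"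
    unfolding moment_def using mp_1_AE_nonneg by (intro integral_nonneg_AE) (auto elim: eventually_mono)
  then show ?thesis by (simp add: half_catalan_def)
qed

lemma half_catalan_nth_0: "half_catalan $ 0 = 1"
  using catalan_fps(2) by (simp add: half_catalan_def moment_fps_def)

text \<open>In \<open>Q = 1 + X c Q\<close> with \<open>c = half_catalan\<close>, nothing is
  negative and \<open>c\<close> has constant term \<open>1\<close>, so no coefficient of
  \<open>Q\<close> falls below its predecessor. This gives nonnegative cumulants and positive
  variance for \<open>mu2\<close>.\<close>

lemma inv_sqrt_nth_ge_1: "1 \<le> inv_sqrt $ n"
proof (induction n rule: less_induct)
  case (less n)
  show ?case
  proof (cases n)
    case 0 then show ?thesis by (simp add: inv_sqrt_nth_0)
  next
    case (Suc m)
    have "inv_sqrt = 1 + fps_X * (half_catalan * inv_sqrt)" using inv_sqrt_mult by (simp add: algebra_simps)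
    then have "inv_sqrt $ Suc m = (1 + fps_X * (half_catalan * inv_sqrt)) $ Suc m" by (rule arg_cong)
    also have "\<dots> = (half_catalan * inv_sqrt) $ m" by simp
    also have "\<dots> = (\<Sum>i=0..m. half_catalan $ i * inv_sqrt $ (m - i))" by (rule fps_mult_nth)
    also have "\<dots> \<ge> half_catalan $ 0 * inv_sqrt $ (m - 0)"
    proof (rule member_le_sum)
      show "0 \<le> half_catalan $ i * inv_sqrt $ (m - i)" if "i \<in> {0..m} - {0}" for i
        using order_trans[OF zero_le_one less[of "m - i"]] Suc by (intro mult_nonneg_nonneg half_catalan_nth_nonneg) auto
    qed auto
    finally show ?thesis using less[of m] Suc by (simp add: half_catalan_nth_0)
  qed
qed

text \<open>The coefficients of \<open>S\<close> are the integrals of \<open>(x/2) (x/2)^k\<close>,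
  and the weight \<open>x/2\<close> is nonnegative on the support.\<close>

lemma psd_inv_sqrt: "psd_upto n (fps_nth inv_sqrt)"
proof -
  let ?\<mu> = "marchenko_pastur 1"
  define S where "S = fps_shift 1 half_catalan"
  have cs: "cs_prob ?\<mu>" by (rule marchenko_pastur_facts) simp
  have psdS: "psd_upto k (fps_nth S)" for k
    unfolding psd_upto_def
  proof
    fix p :: "nat \<Rightarrow> real"
    define g where "g k x = (x / 2) * (x / 2) ^ k" for k and x :: real
    have S: "S $ k = (\<integral>x. g k x \<partial>?\<mu>)" for k
      by (simp add: g_def S_def half_catalan_def moment_def power_divide)
    have int: "integrable ?\<mu> (g k)" for k
      using cs_prob_integrable_power[OF cs, of "Suc k"] by (simp add: g_def[abs_def] power_divide)
    have "(\<Sum>i<k. \<Sum>j<k. p i * p j * S $ (i + j)) 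
        = (\<integral>x. (\<Sum>i<k. \<Sum>j<k. p i * p j * g (i + j) x) \<partial>?\<mu>)"
      unfolding S by (simp add: int)
    also have "\<dots> = (\<integral>x. (x / 2) * (\<Sum>i<k. p i * (x / 2) ^ i)\<^sup>2 \<partial>?\<mu>)"
      by (simp only: g_def power2_eq_square sum_product sum_distrib_left power_add mult_ac)
    also have "0 \<le> \<dots>"
      using mp_1_AE_nonneg by (intro integral_nonneg_AE) (auto elim!: eventually_mono)
    finally show "0 \<le> (\<Sum>i<k. \<Sum>j<k. p i * p j * S $ (i + j))" .
  qed
  have "half_catalan = 1 + fps_X * S"
  proof (rule fps_ext)
    fix n show "half_catalan $ n = (1 + fps_X * S) $ n" by (cases n) (simp_all add: S_def half_catalan_nth_0)
  qed
  then have "1 - fps_X * half_catalan = 1 - fps_X * (1 + fps_X * S)" by (rule arg_cong)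
  also have "\<dots> = 1 - fps_const 1 * fps_X - fps_X\<^sup>2 * S"
    by (simp add: algebra_simps power2_eq_square)
  finally have "1 - fps_X * half_catalan = 1 - fps_const 1 * fps_X - fps_X\<^sup>2 * S" .
  with inv_sqrt_mult have "inv_sqrt * (1 - fps_const 1 * fps_X - fps_X\<^sup>2 * S) = 1" by simp
  from psd_upto_fps_jacobi[OF this psdS, of "n - 1"] show ?thesis
    by (cases n) (simp_all add: psd_upto_def)
qed

text \<open>The moment series is \<open>M = (1 + C) / 2\<close> for the Catalan series
  \<open>C\<close>, and \<open>C = 1 + X C^2\<close> yields \<open>C^2 (1 - 2XM) = 1\<close>. So the
  inverse square root of \<open>1 - 2z\<close> at \<open>z = XM\<close> is \<open>C\<close>, and
  \<open>(C - 1) / 2 = M - 1\<close>.\<close>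

lemma mu2_facts: "cs_prob mu2" "R_transform mu2 = R_mu2"
proof -
  let ?\<nu> = "marchenko_pastur 1"
  have \<nu>: "cs_prob ?\<nu>" and supp: "AE x in ?\<nu>. 0 \<le> x \<and> x \<le> 4"
    using marchenko_pastur_facts(1,2)[of 1] by auto
  interpret real_distribution ?\<nu> by (rule cs_prob_real_distribution[OF \<nu>])
  have "ennreal (1/2) + ennreal (1/2) = ennreal (1/2 + 1/2)"
    by (rule ennreal_plus[symmetric]) auto
  then have "ennreal (1/2) + ennreal (1/2) * emeasure ?\<nu> UNIV = 1"
    using emeasure_space_1 by simp
  note mix = mix_cs_prob[OF events_eq_borel _ _ this _ supp, folded mu2_def]
  show cs: "cs_prob mu2" using mix(1) by simp
  have mom: "moment mu2 n = 1/2 * 0 ^ n + 1/2 * moment ?\<nu> n" for n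
    unfolding moment_def by (rule mix(3)) (use cs_prob_integrable_power[OF \<nu>] in auto)
  define C M where "C = moment_fps ?\<nu>" and "M = moment_fps mu2"
  have C: "C - 1 = fps_X * C\<^sup>2" "C $ 0 = 1" using catalan_fps by (simp_all add: C_def)
  have M: "M = fps_const (1/2) * (1 + C)"
    by (rule fps_ext) (simp add: M_def C_def moment_fps_def mom power_0_left algebra_simps)
  have "2 * M = 1 + C" by (simp add: M numeral_fps_const flip: mult.assoc)
  then have "2 * (fps_X * M) = fps_X * (1 + C)" by (simp only: mult.left_commute)
  moreover have "C * C * (1 - fps_X * (1 + C)) = C * C - fps_X * C\<^sup>2 - fps_X * C\<^sup>2 * C"
    by (simp add: algebra_simps power2_eq_square)
  moreover have "\<dots> = 1" unfolding C(1)[symmetric] by (simp add: algebra_simps)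
  ultimately have "C * C * (1 - 2 * (fps_X * M)) = 1" by (simp only:)
  then have "inv_sqrt oo (fps_X * M) = C" using C(2) by (intro inv_sqrt_compose) simp_all
  then have "(R_mu2 oo (fps_X * M)) + 1 = fps_const (1/2) * (C - 1) + 1" by (simp add: R_mu2_compose)
  also have "\<dots> = M" by (rule fps_ext) (simp add: M algebra_simps)
  finally have "R_fun_eq R_mu2 M" using C(2) by (simp add: R_fun_eq_def M)
  then show "R_transform mu2 = R_mu2" unfolding M_def by (rule R_transform_eqI)
qed

text \<open>The shifted cumulants \<open>2 * 2 ^ n\<close> are the moments of a mass
  \<open>2\<close> at the point \<open>2\<close>.\<close>

lemma R_mu1_nonneg: "0 \<le> R_mu1 $ n" and R_mu1_psd: "psd_upto k (\<lambda>n. R_mu1 $ (n + 2))"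
  using psd_upto_scale[OF psd_upto_power, of 2 k 2] by (simp_all add: R_mu1_nth)

lemma R_mu2_nonneg: "0 \<le> R_mu2 $ n" and R_mu2_pos: "0 < R_mu2 $ 2" and R_mu2_psd: "psd_upto k (\<lambda>n. R_mu2 $ (n + 2))"
proof -
  show "0 \<le> R_mu2 $ n" using inv_sqrt_nth_ge_1[of n] by (cases n) (simp_all add: R_mu2_def inv_sqrt_nth_0)
  show "0 < R_mu2 $ 2" using inv_sqrt_nth_ge_1[of 2] by (simp add: R_mu2_def)
  show "psd_upto k (\<lambda>n. R_mu2 $ (n + 2))"
    using psd_upto_scale[OF psd_upto_shift2[OF psd_inv_sqrt], of "1/2" k] by (simp add: R_mu2_def)
qed

section \<open>The moment series of \<open>mu0\<close>\<close>

lemma one_minus_X_power_nth: "((1 - fps_X) ^ k :: real fps) $ j = (-1) ^ j * real (k choose j)"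
proof (induction k arbitrary: j)
  case (Suc k)
  have "((1 - fps_X) ^ Suc k :: real fps) = (1 - fps_X) ^ k - fps_X * (1 - fps_X) ^ k"
    by (simp add: algebra_simps)
  then show ?case using Suc by (cases j) (simp_all add: algebra_simps)
qed (auto simp: binomial_eq_0_iff)

definition geom :: "real fps" where "geom = inverse (1 - fps_X)"

lemma geom_mult: "geom * (1 - fps_X) = 1"
  unfolding geom_def by (rule inverse_mult_eq_1) simp

lemma geom_nth: "geom $ n = 1"
  using fps_inverse_geometric[of "1::real"] by (simp add: geom_def)

lemma geom_square_nth: "(geom * geom) $ n = real n + 1"
  by (simp add: fps_mult_nth geom_nth)

lemma geom_cube_nth: "(geom * geom * geom) $ n = (real n + 1) * (real n + 2) / 2"
proof -
  have "(geom * geom * geom) $ n = (\<Sum>i\<le>n. real i + 1)"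
    by (subst fps_mult_nth) (simp add: geom_square_nth geom_nth atMost_atLeast0)
  also have "\<dots> = (real n + 1) * (real n + 2) / 2"
    by (induction n) (simp_all add: field_simps)
  finally show ?thesis .
qed

text \<open>Read off at \<open>X\<^sup>m\<close> from \<open>\<Sum>n\<le>m. (-1)\<^bsup>m-n\<^esup> C(m+1, n+1) T\<^sup>n = ((T - 1)\<^bsup>m+1\<^esup> + (-1)\<^sup>m) / T\<close> with
  \<open>T = (1 - X)\<^sup>3\<close>, where \<open>(T - 1)\<^bsup>m+1\<^esup>\<close> has no terms of degree at most \<open>m\<close>.\<close>

lemma alternating_choose_3n_sum:
  "(\<Sum>n\<le>m. (-1) ^ (m - n) * real (Suc m choose Suc n) * real (3 * n choose m)) = (real m + 1) * (real m + 2) / 2"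
proof -
  define T :: "real fps" where "T = (1 - fps_X) ^ 3"
  have TJ: "T * (geom * geom * geom) = 1"
  proof -
    have "T * (geom * geom * geom) = (geom * (1 - fps_X)) ^ 3"
      unfolding T_def power3_eq_cube by (simp only: mult_ac)
    then show ?thesis by (simp add: geom_mult)
  qed
  define P where "P = (\<Sum>n\<le>m. of_int ((-1) ^ (m - n) * int (Suc m choose Suc n)) * T ^ n)"
  have "(T + (-1)) ^ Suc m = (\<Sum>k\<le>Suc m. of_nat (Suc m choose k) * T ^ k * (-1) ^ (Suc m - k))"
    by (rule binomial_ring)
  also have "\<dots> = (-1) ^ Suc m + (\<Sum>n\<le>m. of_nat (Suc m choose Suc n) * T ^ Suc n * (-1) ^ (m - n))"
    by (subst sum.atMost_Suc_shift) simp
  also have "(\<Sum>n\<le>m. of_nat (Suc m choose Suc n) * T ^ Suc n * (-1) ^ (m - n)) = T * P"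
    by (simp add: P_def sum_distrib_left mult_ac)
  finally have TP: "T * P = (T - 1) ^ Suc m + (-1) ^ m" by simp
  have "P = (T * (geom * geom * geom)) * P" by (simp add: TJ)
  also have "\<dots> = (T * P) * (geom * geom * geom)" by (simp only: mult_ac)
  finally have P: "P = (T - 1) ^ Suc m * (geom * geom * geom) + (-1) ^ m * (geom * geom * geom)"
    unfolding TP distrib_right .
  have "(T - 1) $ 0 = 0" by (simp add: T_def fps_power_zeroth)
  then have z: "((T - 1) ^ Suc m) $ i = 0" if "i \<le> m" for i
    using that startsby_zero_power_prefix[of "T - 1" "Suc m"] by auto
  have "((T - 1) ^ Suc m * (geom * geom * geom)) $ m = 0"
    unfolding fps_mult_nth[of "(T - 1) ^ Suc m"] by (intro sum.neutral) (simp add: z del: power_Suc)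
  then have "P $ m = ((-1) ^ m * (geom * geom * geom)) $ m" by (simp add: P)
  also have "((-1) ^ m :: real fps) = fps_const ((-1) ^ m)"
    by (simp add: fps_const_power[symmetric] fps_const_neg[symmetric] del: fps_const_neg fps_const_power)
  also have "(fps_const ((-1) ^ m) * (geom * geom * geom)) $ m = (-1) ^ m * ((real m + 1) * (real m + 2) / 2)"
    by (simp add: geom_cube_nth)
  also have "P $ m = (\<Sum>n\<le>m. (-1) ^ (m - n) * real (Suc m choose Suc n) * ((-1) ^ m * real (3 * n choose m)))"
    unfolding P_def fps_sum_nth T_def fps_mult_of_int_nth power_mult[symmetric] one_minus_X_power_nth by simp
  finally have "(-1) ^ m * (\<Sum>n\<le>m. (-1) ^ (m - n) * real (Suc m choose Suc n) * real (3 * n choose m))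
     = (-1) ^ m * ((real m + 1) * (real m + 2) / 2)"
    by (simp add: sum_distrib_left mult_ac)
  then show ?thesis by simp
qed

definition binom3_fps :: "real fps" where
  "binom3_fps = Abs_fps (\<lambda>n. real ((3 * n) choose n) / real (n + 1))"

text \<open>With \<open>B = 1 / (1 - v)\<close> this is \<open>z = (B - 1) / B^3\<close>, the
  equation \<open>B = 1 + z B^3\<close> for the generating function of ternary trees.\<close>

definition cubic :: "real fps" where "cubic = fps_X * (1 - fps_X)\<^sup>2"

text \<open>Writing \<open>C\<close> for binomial coefficients,
  \<open>C(3n,n) C(2n,m-n) = C(3n,m) C(m,n)\<close> and
  \<open>C(m,n) / (n+1) = C(m+1,n+1) / (m+1)\<close> reduce each coefficient to
  \<open>alternating_choose_3n_sum\<close>, leaving \<open>(m + 2) / 2\<close>.\<close>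

lemma binom3_fps_compose: "binom3_fps oo cubic = fps_const (1/2) * (geom + geom * geom)"
proof (rule fps_ext)
  fix m
  have coeff: "binom3_fps $ n * (cubic ^ n) $ m
     = (-1) ^ (m - n) * real (Suc m choose Suc n) * real (3 * n choose m) / (real m + 1)" if "n \<le> m" for n
  proof -
    have "(cubic ^ n) $ m = (-1) ^ (m - n) * real (2 * n choose (m - n))"
      using that by (simp add: cubic_def power_mult_distrib fps_X_power_mult_nth one_minus_X_power_nth flip: power_mult)
    moreover have "(3 * n choose n) * (2 * n choose (m - n)) = (3 * n choose m) * (m choose n)"
    proof (cases "m \<le> 3 * n")
      case True
      then show ?thesis using choose_mult[OF that True] by simp
    next
      \<comment> \<open>Both sides vanish, since \<open>m - n > 2 * n\<close>.\<close>
      case False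
      then show ?thesis by (simp add: binomial_eq_0)
    qed
    moreover have ratio: "real (m choose n) / real (n + 1) = real (Suc m choose Suc n) / (real m + 1)"
    proof -
      have "Suc m * (m choose n) = (Suc m choose Suc n) * Suc n" by (rule Suc_times_binomial_eq)
      then have "real (Suc m) * real (m choose n) = real (Suc m choose Suc n) * real (Suc n)"
        by (simp only: of_nat_mult[symmetric])
      then show ?thesis by (simp add: field_simps)
    qed
    ultimately have "binom3_fps $ n * (cubic ^ n) $ m = (-1) ^ (m - n) * (real (3 * n choose n) * real (2 * n choose (m - n))) / real (n + 1)"
      and "real (3 * n choose n) * real (2 * n choose (m - n)) = real (3 * n choose m) * real (m choose n)"
      by (simp_all add: binom3_fps_def flip: of_nat_mult)
    then have "binom3_fps $ n * (cubic ^ n) $ m = (-1) ^ (m - n) * real (3 * n choose m) * (real (m choose n) / real (n + 1))"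
      by simp
    then show ?thesis unfolding ratio by (simp add: mult_ac)
  qed
  have "(binom3_fps oo cubic) $ m = (\<Sum>n\<le>m. (-1) ^ (m - n) * real (Suc m choose Suc n) * real (3 * n choose m) / (real m + 1))"
    unfolding fps_compose_nth atLeast0AtMost by (intro sum.cong refl coeff) simp
  also have "\<dots> = ((real m + 1) * (real m + 2) / 2) / (real m + 1)"
    unfolding sum_divide_distrib[symmetric] alternating_choose_3n_sum ..
  also have "\<dots> = (fps_const (1/2) * (geom + geom * geom)) $ m"
    unfolding fps_mult_left_const_nth fps_add_nth geom_nth geom_square_nth by (simp add: field_simps)
  finally show "(binom3_fps oo cubic) $ m = (fps_const (1/2) * (geom + geom * geom)) $ m" .
qed

text \<open>Composition with \<open>cubic\<close> is injective, so the equation may be checked after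
  it. With \<open>B = 1 / (1 - X)\<close> one has \<open>1 - 2 \<omega> = 1 / B^2\<close>, and the
  two R-transforms at \<open>\<omega>\<close> are \<open>(B^2 - 1) / 2\<close> and
  \<open>(B - 1) / 2\<close>, which add up to the composed series minus \<open>1\<close>.\<close>

lemma R_fun_eq_binom3: "R_fun_eq (R_mu1 + R_mu2) binom3_fps"
  unfolding R_fun_eq_def
proof
  show M00: "binom3_fps $ 0 = 1" by (simp add: binom3_fps_def)
  define \<omega> where "\<omega> = (fps_X * binom3_fps) oo cubic"
  have cubic: "cubic $ 0 = 0" "cubic $ 1 \<noteq> 0" by (simp_all add: cubic_def power2_eq_square)
  have \<omega>0: "\<omega> $ 0 = 0" by (simp add: \<omega>_def)
  have h: "2 * fps_const (1/2) = (1 :: real fps)" by (simp add: numeral_fps_const)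
  have "2 * \<omega> = (2 * fps_const (1/2)) * (fps_X * (1 - fps_X)\<^sup>2 * (geom + geom * geom))"
  proof -
    have "\<omega> = cubic * (binom3_fps oo cubic)" using cubic(1) by (simp add: \<omega>_def fps_compose_mult_distrib)
    then show ?thesis unfolding binom3_fps_compose by (simp only: cubic_def mult_ac)
  qed
  also have "\<dots> = fps_X * ((geom * (1 - fps_X)) * (1 - fps_X) + (geom * (1 - fps_X)) * (geom * (1 - fps_X)))"
    unfolding h by (simp add: algebra_simps power2_eq_square)
  finally have \<omega>2: "2 * \<omega> = fps_X * ((1 - fps_X) + 1)" unfolding geom_mult by simp
  then have \<omega>: "1 - 2 * \<omega> = (1 - fps_X) * (1 - fps_X)" by (simp add: algebra_simps)
  have JJ: "geom * geom * (1 - 2 * \<omega>) = 1"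
  proof -
    have "geom * geom * (1 - 2 * \<omega>) = (geom * (1 - fps_X)) * (geom * (1 - fps_X))" unfolding \<omega> by (simp only: mult_ac)
    then show ?thesis by (simp add: geom_mult)
  qed
  have inv_sqrt: "inv_sqrt oo \<omega> = geom" by (rule inv_sqrt_compose[OF \<omega>0 JJ]) (simp add: geom_nth)
  have inv: "inverse (1 - 2 * \<omega>) = geom * geom"
    by (rule fps_inverse_unique[OF trans[OF mult.commute JJ]])
  have R_mu1: "R_mu1 oo \<omega> = \<omega> * (geom * geom)"
    using R_mu1_compose[OF \<omega>0] inv by (simp only: numeral_fps_const)
  have "2 * ((R_mu1 + R_mu2) oo \<omega>) = 2 * (\<omega> * (geom * geom)) + (2 * fps_const (1/2)) * (geom - 1)"
    by (simp only: fps_compose_add_distrib R_mu1 R_mu2_compose[OF \<omega>0] inv_sqrt distrib_left mult.assoc)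
  also have "\<dots> = (2 * \<omega>) * (geom * geom) + (geom - 1)" unfolding h by (simp only: mult.assoc mult_1)
  also have "(2 * \<omega>) * (geom * geom) = geom * geom - 1"
  proof -
    have "geom * geom - (2 * \<omega>) * (geom * geom) = geom * geom * (1 - 2 * \<omega>)"
      by (simp only: right_diff_distrib mult_1_left mult_1_right mult_ac)
    then have "geom * geom - (2 * \<omega>) * (geom * geom) = 1" by (simp only: JJ)
    then show ?thesis by (simp only: diff_eq_eq eq_diff_eq add.commute)
  qed
  finally have "2 * ((R_mu1 + R_mu2) oo \<omega>) = geom + geom * geom - 2" by simp
  also have "\<dots> = 2 * ((binom3_fps oo cubic) - 1)"
    unfolding binom3_fps_compose right_diff_distrib mult.assoc[symmetric] h by simp
  finally have "(R_mu1 + R_mu2) oo \<omega> = (binom3_fps oo cubic) - 1" by (subst (asm) mult_left_cancel) simp_all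
  moreover have "(((R_mu1 + R_mu2) oo (fps_X * binom3_fps)) oo cubic) = (R_mu1 + R_mu2) oo \<omega>"
    using cubic unfolding \<omega>_def by (subst fps_compose_assoc) simp_all
  ultimately have "(((R_mu1 + R_mu2) oo (fps_X * binom3_fps)) + 1) oo cubic = binom3_fps oo cubic"
    by (simp add: fps_compose_add_distrib)
  then show "((R_mu1 + R_mu2) oo (fps_X * binom3_fps)) + 1 = binom3_fps"
    using fps_compose_inj_right[OF cubic] by blast
qed

section \<open>Compact support of \<open>mu0\<close> and conclusion\<close>

lemma (in real_distribution) AE_bounded_of_moments:
  assumes int: "\<And>n. integrable M (\<lambda>x. x ^ n)" and K: "\<And>n. moment M n \<le> K ^ n" and L: "0 \<le> K" "K < L"
  shows "AE x in M. \<bar>x\<bar> \<le> L"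
proof -
  define p where "p = prob {x \<in> space M. L \<le> \<bar>x\<bar>}"
  \<comment> \<open>Markov's inequality for the even powers of \<open>x\<close>; the strict gap
    between \<open>K\<close> and \<open>L\<close> makes the bound tend to \<open>0\<close>.\<close>
  have le: "p \<le> ((K / L)\<^sup>2) ^ n" for n
  proof -
    have "{x \<in> space M. L \<le> \<bar>x\<bar>} \<subseteq> {x \<in> space M. L ^ (2 * n) \<le> x ^ (2 * n)}"
    proof safe
      fix x assume "L \<le> \<bar>x\<bar>"
      then have "L ^ (2 * n) \<le> \<bar>x\<bar> ^ (2 * n)" using L by (intro power_mono) auto
      then show "L ^ (2 * n) \<le> x ^ (2 * n)" by (simp add: power_even_abs)
    qed
    then have "p \<le> prob {x \<in> space M. L ^ (2 * n) \<le> x ^ (2 * n)}"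
      unfolding p_def by (intro finite_measure_mono) auto
    also have "\<dots> \<le> expectation (\<lambda>x. x ^ (2 * n)) / L ^ (2 * n)"
      using L by (intro integral_Markov_inequality_measure[OF int sets.top]) (auto simp: power_mult)
    also have "\<dots> \<le> K ^ (2 * n) / L ^ (2 * n)"
      using K[of "2 * n"] L by (intro divide_right_mono) (auto simp: moment_def)
    also have "\<dots> = ((K / L)\<^sup>2) ^ n" by (simp add: power_divide power_mult)
    finally show ?thesis .
  qed
  have "\<bar>(K / L)\<^sup>2\<bar> < 1" using L by (simp add: power_less_one_iff abs_square_less_1)
  then have "(\<lambda>n. ((K / L)\<^sup>2) ^ n) \<longlonglongrightarrow> 0" by (intro LIMSEQ_power_zero) simp
  then have "p \<le> 0" by (rule LIMSEQ_le_const) (use le in auto)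
  then have "p = 0" by (simp add: p_def measure_le_0_iff)
  then have "AE x in M. \<not> L \<le> \<bar>x\<bar>"
    unfolding p_def by (subst (asm) prob_eq_0) auto
  then show ?thesis by eventually_elim simp
qed

theorem mainTheorem6:
  fixes mu0 :: "real measure"
  assumes "prob_space mu0" and "sets mu0 = sets borel"
    and "\<And>n. integrable mu0 (\<lambda>t. t ^ n)"
    and "\<And>n. moment mu0 n = real ((3 * n) choose n) / real (n + 1)"
  shows "mu0 = free_conv mu1 mu2 \<and> free_inf_div mu1 \<and> free_inf_div mu2 \<and> free_inf_div mu0"
proof -
  have rd: "real_distribution mu0"
    using assms(1,2) by (simp add: real_distribution_def real_distribution_axioms_def)
  have "moment mu0 n \<le> 8 ^ n" for n
  proof -
    have "real (3 * n choose n) \<le> real (2 ^ (3 * n))"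
      using binomial_le_pow2[of "3 * n" n] by (simp only: of_nat_le_iff)
    moreover have "real (3 * n choose n) / real (n + 1) \<le> real (3 * n choose n)"
      by (simp add: divide_le_eq mult_left_le)
    ultimately have "real (3 * n choose n) / real (n + 1) \<le> real (2 ^ (3 * n))" by linarith
    then show ?thesis by (simp only: assms(4)) (simp add: power_mult)
  qed
  \<comment> \<open>The crude estimate by \<open>2 ^ (3 * n) = 8 ^ n\<close> suffices;
    \<open>9\<close> merely has to exceed \<open>8\<close>.\<close>
  then have "AE x in mu0. \<bar>x\<bar> \<le> 9"
    by (intro real_distribution.AE_bounded_of_moments[OF rd, of 8] assms(3)) auto
  with rd have cs: "cs_prob mu0" by (rule cs_probI)
  have "moment_fps mu0 = binom3_fps" by (simp add: moment_fps_def binom3_fps_def assms(4) fps_eq_iff)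
  then have R: "R_transform mu0 = R_mu1 + R_mu2" using R_fun_eq_binom3 by (intro R_transform_eqI) simp
  have "free_conv mu1 mu2 = mu0"
    using cs R by (intro free_conv_eqI) (simp_all add: mu1_facts mu2_facts)
  moreover have "free_inf_div mu1"
    by (rule free_inf_divI[OF mu1_facts(1)]) (simp_all only: mu1_facts R_mu1_nonneg R_mu1_psd, simp add: R_mu1_nth)
  moreover have "free_inf_div mu2"
    by (rule free_inf_divI[OF mu2_facts(1)]) (simp_all only: mu2_facts R_mu2_nonneg R_mu2_psd R_mu2_pos)
  moreover have "free_inf_div mu0"
    by (rule free_inf_divI[OF cs])
       (use R_mu1_nonneg R_mu2_nonneg R_mu2_pos R_mu1_psd R_mu2_psd in
         \<open>auto simp: R intro!: add_nonneg_nonneg add_nonneg_pos psd_upto_add\<close>)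
  ultimately show ?thesis by simp
qed

end
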